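(* Cayley digraphs on dihedral groups and on the groups of symmetries of regular polyhedra are polynomial. That is, if $\Gamma$ is a dihedral group or the group of symmetries of a regular polyhedron, and $S\subseteq\Gamma$ is a finite set not containing the identity, then the Cayley digraph $\mathrm{Cay}(\Gamma,S)$ is polynomial.
   Context: The dihedral groups are $D_{2n}=\langle f,t \mid f^n=t^2=1,\ tftf=1\rangle$. The dihedral groups and the groups of symmetries of regular polyhedra are considered here as finite subgroups of the group, under composition, of linear fractional transformations $z\mapsto(az+b)/(cz+d)$ with $a,b,c,d\in\mathbb{C}$, $ad-bc\neq0$. For a group $\Gamma$ and a finite set $S\subseteq\Gamma$ not containing the identity, the Cayley digraph $\mathrm{Cay}(\Gamma,S)$ has vertex set $\Gamma$, and $(u,v)$ is an arc if $v=su$ for some $s\in S$; $S$ is not required to generate $\Gamma$. Digraphs may be infinite and may have loops and multiple arcs. The (weakly connected) component of a vertex $u$ is the subdigraph induced by all vertices joined to $u$ by a path when arc directions are ignored. For $\Phi(x,y)\in\mathbb{C}[x,y]$, the digraph $G(\Phi)$ has vertex set $\mathbb{C}$, and $(u,v)$ is an arc of multiplicity $m\ge1$ if $v$ is a root of multiplicity $m$ of $\Phi(u,y)$ (if $\Phi(u,y)$ is the zero polynomial, every $(u,v)$ is an arc of multiplicity $1$). Write $\Phi(x,y)=\sum_{i=0}^{p} \alpha_i(x)y^i=\sum_{j=0}^{q} \beta_j(y)x^j$ with $\alpha_p,\beta_q\neq 0$, and set $A(x)=\gcd(\alpha_0,\dots,\alpha_p)$, $B(y)=\gcd(\beta_0,\dots,\beta_q)$,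 $D(x)=\mathrm{Resultant}(\Phi,\Phi'_y,y)$, $E(y)=\mathrm{Resultant}(\Phi,\Phi'_x,x)$, $L(x)=\Phi(x,x)$, where $\Phi'_x,\Phi'_y$ are the partial derivatives. $\Phi$ is standard if it is non-constant, $A$ and $B$ are constant, and none of $D$, $E$, $L$ is the zero polynomial (non-vanishing of $D$ and $E$ means that $\Phi$ has no repeated non-constant factor). For standard $\Phi$, the singular vertices are the roots of $L(x)D(x)E(x)$; equivalently, the vertices $u$ that have a loop, or are the origin or end of a multiple arc, or have $\alpha_p(u)=0$ or $\beta_q(u)=0$. A singular component is a component containing a singular vertex. A $k$-regular digraph (all indegrees and outdegrees equal to $k$) is called polynomial if, for some standard polynomial $\Phi(x,y)$, it is isomorphic to $G(\Phi)$ or to a non-singular component of $G(\Phi)$.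
   Formalization: Cay(Γ,S) is shown polynomial when S generates Γ (otherwise it is finite and disconnected, so the claim fails); for other nonempty S, each component is polynomial and Cay(Γ,S) is a union of non-singular components of one G(Φ). Polyhedral symmetries are taken as rotations. *)

theory Defs
  imports
    "HOL-Analysis.Polytope"
    "HOL-Analysis.Determinants"
    "HOL-Algebra.Generated_Groups"
    "HOL-Computational_Algebra.Polynomial_Factorial"
    "HOL-Computational_Algebra.Field_as_Ring"
    "Graph_Theory.Digraph_Isomorphism"
    "Subresultants.Resultant_Prelim"
begin

section \<open>Bivariate polynomials and their digraphs\<close>

text \<open>
  \<open>\<Phi>(x,y) \<in> \<complex>[x,y]\<close> is represented as a polynomial in \<open>y\<close> over \<open>\<complex>[x]\<close>, so that
  \<open>coeff \<Phi> i\<close> is \<open>\<alpha>\<^sub>i(x)\<close>. After exchanging the variables, \<open>coeff (swap_vars \<Phi>) j\<close> is \<open>\<beta>\<^sub>j(y)\<close>.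
\<close>

type_synonym bipoly = "complex poly poly"

definition swap_vars :: "bipoly \<Rightarrow> bipoly" where
  "swap_vars \<Phi> = (\<Sum>i\<le>degree \<Phi>. \<Sum>j\<le>degree (coeff \<Phi> i).
      monom (monom (coeff (coeff \<Phi> i) j) i) j)"

lemma coeff_swap_vars: "coeff (coeff (swap_vars \<Phi>) j) i = coeff (coeff \<Phi> i) j"
proof -
  have "coeff (coeff (swap_vars \<Phi>) j) i =
      (\<Sum>i'\<le>degree \<Phi>. \<Sum>j'\<le>degree (coeff \<Phi> i').
        if j' = j then (if i' = i then coeff (coeff \<Phi> i') j' else 0) else 0)"
    by (simp add: swap_vars_def coeff_sum if_distrib [of "\<lambda>p. coeff p i"] cong: if_cong)
  also have "\<dots> = (\<Sum>i'\<le>degree \<Phi>. if i' = i then coeff (coeff \<Phi> i') j else 0)"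
    by (rule sum.cong) (auto simp: sum.delta le_degree coeff_eq_0 not_le)
  also have "\<dots> = coeff (coeff \<Phi> i) j"
    by (auto simp: sum.delta coeff_eq_0 not_le)
  finally show ?thesis .
qed

definition eval_x :: "bipoly \<Rightarrow> complex \<Rightarrow> complex poly" where
  "eval_x \<Phi> u = map_poly (\<lambda>a. poly a u) \<Phi>"

definition arc_mult :: "bipoly \<Rightarrow> complex \<Rightarrow> complex \<Rightarrow> nat" where
  "arc_mult \<Phi> u v = (if eval_x \<Phi> u = 0 then 1 else Polynomial.order v (eval_x \<Phi> u))"

text \<open>An arc of multiplicity \<open>m\<close> from \<open>u\<close> to \<open>v\<close> is the family of arcs \<open>(u,v,i)\<close>, \<open>i < m\<close>.\<close>

definition poly_digraph :: "bipoly \<Rightarrow> (complex, complex \<times> complex \<times> nat) pre_digraph" where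
  "poly_digraph \<Phi> = \<lparr> verts = UNIV, arcs = {(u, v, i). i < arc_mult \<Phi> u v},
     tail = (\<lambda>(u, v, i). u), head = (\<lambda>(u, v, i). v) \<rparr>"

definition D_poly :: "bipoly \<Rightarrow> complex poly" where
  "D_poly \<Phi> = resultant \<Phi> (pderiv \<Phi>)"

definition E_poly :: "bipoly \<Rightarrow> complex poly" where
  "E_poly \<Phi> = resultant (swap_vars \<Phi>) (pderiv (swap_vars \<Phi>))"

text \<open>\<open>L(x) = \<Phi>(x,x)\<close>: the polynomial \<open>x\<close> is substituted for \<open>y\<close>.\<close>

definition L_poly :: "bipoly \<Rightarrow> complex poly" where
  "L_poly \<Phi> = poly \<Phi> [:0, 1:]"

text \<open>\<open>content\<close> is the gcd of the coefficients, so the two degree conditions say that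
  \<open>A(x)\<close> and \<open>B(y)\<close> are constant.\<close>

definition standard_poly :: "bipoly \<Rightarrow> bool" where
  "standard_poly \<Phi> \<longleftrightarrow>
     (\<nexists>c. \<Phi> = [:[:c:]:]) \<and>
     degree (content \<Phi>) = 0 \<and> degree (content (swap_vars \<Phi>)) = 0 \<and>
     D_poly \<Phi> \<noteq> 0 \<and> E_poly \<Phi> \<noteq> 0 \<and> L_poly \<Phi> \<noteq> 0"

definition singular_vertex :: "bipoly \<Rightarrow> complex \<Rightarrow> bool" where
  "singular_vertex \<Phi> u \<longleftrightarrow> poly (L_poly \<Phi> * D_poly \<Phi> * E_poly \<Phi>) u = 0"


section \<open>Weak components, regularity, and polynomial digraphs\<close>

definition component_verts :: "('a, 'b) pre_digraph \<Rightarrow> 'a \<Rightarrow> 'a set" where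
  "component_verts G u = {v. u \<rightarrow>\<^sup>*\<^bsub>with_proj (mk_symmetric G)\<^esub> v}"

definition component :: "('a, 'b) pre_digraph \<Rightarrow> 'a \<Rightarrow> ('a, 'b) pre_digraph" where
  "component G u = G \<restriction> component_verts G u"

definition nonsingular_component_of :: "bipoly \<Rightarrow> complex \<Rightarrow> bool" where
  "nonsingular_component_of \<Phi> u \<longleftrightarrow>
     (\<forall>v \<in> component_verts (poly_digraph \<Phi>) u. \<not> singular_vertex \<Phi> v)"

definition regular_digraph :: "nat \<Rightarrow> ('a, 'b) pre_digraph \<Rightarrow> bool" where
  "regular_digraph k G \<longleftrightarrow> wf_digraph G \<and>
     (\<forall>v \<in> verts G. finite (in_arcs G v) \<and> finite (out_arcs G v) \<and>
        in_degree G v = k \<and> out_degree G v = k)"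

definition polynomial_digraph :: "('a, 'b) pre_digraph \<Rightarrow> bool" where
  "polynomial_digraph G \<longleftrightarrow> (\<exists>k. regular_digraph k G) \<and>
     (\<exists>\<Phi>. standard_poly \<Phi> \<and>
        (digraph_iso G (poly_digraph \<Phi>) \<or>
         (\<exists>u. nonsingular_component_of \<Phi> u \<and> digraph_iso G (component (poly_digraph \<Phi>) u))))"

definition union_of_nonsingular_components :: "bipoly \<Rightarrow> complex set \<Rightarrow> bool" where
  "union_of_nonsingular_components \<Phi> V \<longleftrightarrow>
     (\<forall>u \<in> V. nonsingular_component_of \<Phi> u \<and> component_verts (poly_digraph \<Phi>) u \<subseteq> V)"


section \<open>Cayley digraphs\<close>

definition cayley_digraph :: "('g, 'm) monoid_scheme \<Rightarrow> 'g set \<Rightarrow> ('g, 'g \<times> 'g) pre_digraph" where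
  "cayley_digraph \<Gamma> S = \<lparr> verts = carrier \<Gamma>,
     arcs = {(u, s \<otimes>\<^bsub>\<Gamma>\<^esub> u) | u s. u \<in> carrier \<Gamma> \<and> s \<in> S},
     tail = fst, head = snd \<rparr>"

text \<open>
  Components are connected and \<open>poly_digraph \<Phi>\<close> is infinite, so a Cayley digraph of a finite
  group can be polynomial only if the connection set generates the group.
\<close>

lemma polynomial_cayley_digraph_imp_generate:
  fixes \<Gamma> :: "('g, 'm) monoid_scheme"
  assumes "group \<Gamma>" and fin: "finite (carrier \<Gamma>)" and S: "S \<subseteq> carrier \<Gamma>"
    and poly: "polynomial_digraph (cayley_digraph \<Gamma> S)"
  shows "generate \<Gamma> S = carrier \<Gamma>"
proof -
  interpret group \<Gamma> by fact
  let ?C = "cayley_digraph \<Gamma> S"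
  let ?H = "generate \<Gamma> S"
  have HC: "?H \<subseteq> carrier \<Gamma>" by (rule generate_incl [OF S])
  have SH: "S \<subseteq> ?H" by (auto intro: generate.incl)
  from poly obtain \<Phi> where "digraph_iso ?C (poly_digraph \<Phi>) \<or>
      (\<exists>u. digraph_iso ?C (component (poly_digraph \<Phi>) u))"
    unfolding polynomial_digraph_def by blast
  moreover have "\<not> digraph_iso ?C (poly_digraph \<Phi>)"
  proof
    assume "digraph_iso ?C (poly_digraph \<Phi>)"
    then obtain f where "poly_digraph \<Phi> = app_iso f ?C" unfolding digraph_iso_def by blast
    then have "verts (poly_digraph \<Phi>) = iso_verts f ` carrier \<Gamma>"
      by (simp add: cayley_digraph_def)
    then have "finite (UNIV :: complex set)"
      using fin by (metis finite_imageI poly_digraph_def pre_digraph.select_convs(1))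
    then show False by (simp add: infinite_UNIV_char_0)
  qed
  ultimately obtain u f where iso: "pre_digraph.digraph_isomorphism ?C f"
      and eq: "component (poly_digraph \<Phi>) u = app_iso f ?C"
    unfolding digraph_iso_def by blast
  let ?G = "poly_digraph \<Phi>" and ?V = "component_verts (poly_digraph \<Phi>) u"
  have V: "?V = iso_verts f ` carrier \<Gamma>"
    using arg_cong [OF eq, of verts] by (simp add: component_def cayley_digraph_def)
  have "wf_digraph ?G" by unfold_locales (auto simp: poly_digraph_def)
  then interpret G: wf_digraph ?G .
  interpret M: pair_wf_digraph "mk_symmetric ?G"
    by (rule G.wellformed_mk_symmetric)
  have inj: "inj_on (iso_verts f) (carrier \<Gamma>)"
    using iso by (simp add: pre_digraph.digraph_isomorphism_def cayley_digraph_def)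
  have "u \<in> ?V"
  proof -
    have "u \<in> pverts (mk_symmetric ?G)" by (simp add: mk_symmetric_def poly_digraph_def)
    then show ?thesis using M.reachable_refl [of u] by (simp add: component_verts_def)
  qed
  then obtain a where a: "a \<in> carrier \<Gamma>" "u = iso_verts f a" using V by auto
  have arc: "\<exists>g s. g \<in> carrier \<Gamma> \<and> s \<in> S \<and> iso_verts f g = tail ?G e \<and>
      iso_verts f (s \<otimes>\<^bsub>\<Gamma>\<^esub> g) = head ?G e"
    if e: "e \<in> arcs ?G" "tail ?G e \<in> ?V" "head ?G e \<in> ?V" for e
  proof -
    have "e \<in> arcs (component ?G u)" using e by (simp add: component_def)
    then obtain e' where e': "e' \<in> arcs ?C" "e = iso_arcs f e'" unfolding eq by auto
    have "tail ?G e = iso_tail f e" "head ?G e = iso_head f e"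
      using arg_cong [OF eq, of tail] arg_cong [OF eq, of head] by (simp_all add: component_def)
    moreover have "iso_tail f e = iso_verts f (fst e')" "iso_head f e = iso_verts f (snd e')"
      using pre_digraph.iso_verts_tail [OF iso e'(1)] pre_digraph.iso_verts_head [OF iso e'(1)] e'(2)
      by (simp_all add: cayley_digraph_def)
    ultimately show ?thesis using e'(1) by (fastforce simp: cayley_digraph_def)
  qed
  have "v \<in> iso_verts f ` (?H #>\<^bsub>\<Gamma>\<^esub> a)" if "v \<in> ?V" for v
  proof -
    have "u \<rightarrow>\<^sup>*\<^bsub>with_proj (mk_symmetric ?G)\<^esub> v" using that by (simp add: component_verts_def)
    then show ?thesis
    proof (induct rule: M.reachable_induct)
      case base
      then show ?case using a generate.one [of \<Gamma> S] by (force simp: r_coset_def)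
    next
      case (step x y)
      have xy: "x \<in> ?V" "y \<in> ?V"
        using step(1) M.reachable_adj_trans [OF step(1,2)] by (auto simp: component_verts_def)
      obtain h where h: "h \<in> ?H" "x = iso_verts f (h \<otimes>\<^bsub>\<Gamma>\<^esub> a)"
        using step(3) by (auto simp: r_coset_def)
      then have hC: "h \<in> carrier \<Gamma>" using HC by auto
      obtain e where e: "e \<in> arcs ?G" "tail ?G e = x \<and> head ?G e = y \<or> tail ?G e = y \<and> head ?G e = x"
        using step(2) by (auto simp: mk_symmetric_def arcs_ends_conv)
      obtain g s where g: "g \<in> carrier \<Gamma>" "s \<in> S" "iso_verts f g = tail ?G e"
          "iso_verts f (s \<otimes>\<^bsub>\<Gamma>\<^esub> g) = head ?G e"
        using arc [OF e(1)] e(2) xy by metis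
      have sC: "s \<in> carrier \<Gamma>" using g(2) S by auto
      show ?case using e(2)
      proof (elim disjE conjE)
        assume 1: "tail ?G e = x" "head ?G e = y"
        then have "g = h \<otimes>\<^bsub>\<Gamma>\<^esub> a"
          using g h hC a inj by (metis inj_onD m_closed)
        then have "y = iso_verts f ((s \<otimes>\<^bsub>\<Gamma>\<^esub> h) \<otimes>\<^bsub>\<Gamma>\<^esub> a)"
          using g 1 hC sC a by (simp add: m_assoc)
        moreover have "s \<otimes>\<^bsub>\<Gamma>\<^esub> h \<in> ?H" using g(2) h(1) SH by (auto intro: generate.eng)
        ultimately show ?thesis by (auto simp: r_coset_def)
      next
        assume 1: "tail ?G e = y" "head ?G e = x"
        then have "s \<otimes>\<^bsub>\<Gamma>\<^esub> g = h \<otimes>\<^bsub>\<Gamma>\<^esub> a"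
          using g h hC sC a inj by (metis inj_onD m_closed)
        then have "g = inv\<^bsub>\<Gamma>\<^esub> s \<otimes>\<^bsub>\<Gamma>\<^esub> (h \<otimes>\<^bsub>\<Gamma>\<^esub> a)"
          using g hC sC a by (metis inv_solve_left m_closed)
        then have "g = (inv\<^bsub>\<Gamma>\<^esub> s \<otimes>\<^bsub>\<Gamma>\<^esub> h) \<otimes>\<^bsub>\<Gamma>\<^esub> a"
          using hC sC a by (simp add: m_assoc)
        moreover have "inv\<^bsub>\<Gamma>\<^esub> s \<otimes>\<^bsub>\<Gamma>\<^esub> h \<in> ?H"
          using g(2) h(1) by (auto intro: generate.eng generate.inv)
        ultimately show ?thesis using g(3) 1 by (auto simp: r_coset_def)
      qed
    qed
  qed
  then have "iso_verts f ` carrier \<Gamma> \<subseteq> iso_verts f ` (?H #>\<^bsub>\<Gamma>\<^esub> a)" using V by auto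
  have "?H #>\<^bsub>\<Gamma>\<^esub> a \<subseteq> carrier \<Gamma>" using HC a(1) by (rule r_coset_subset_G)
  have sub: "carrier \<Gamma> \<subseteq> ?H #>\<^bsub>\<Gamma>\<^esub> a"
  proof
    fix x assume x: "x \<in> carrier \<Gamma>"
    then obtain y where "y \<in> ?H #>\<^bsub>\<Gamma>\<^esub> a" "iso_verts f x = iso_verts f y"
      using \<open>iso_verts f ` carrier \<Gamma> \<subseteq> _\<close> by blast
    then show "x \<in> ?H #>\<^bsub>\<Gamma>\<^esub> a"
      using x \<open>?H #>\<^bsub>\<Gamma>\<^esub> a \<subseteq> carrier \<Gamma>\<close> inj by (auto dest: inj_onD)
  qed
  have sg: "subgroup ?H \<Gamma>" by (rule generate_is_subgroup [OF S])
  have "\<one>\<^bsub>\<Gamma>\<^esub> \<in> ?H #>\<^bsub>\<Gamma>\<^esub> a" using sub by auto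
  then obtain h where h: "h \<in> ?H" "\<one>\<^bsub>\<Gamma>\<^esub> = h \<otimes>\<^bsub>\<Gamma>\<^esub> a" by (auto simp: r_coset_def)
  then have "inv\<^bsub>\<Gamma>\<^esub> a = h" using a(1) HC by (intro inv_equality) auto
  then have "a = inv\<^bsub>\<Gamma>\<^esub> h" using a(1) by auto
  then have "a \<in> ?H" using h(1) sg by (simp add: subgroup.m_inv_closed)
  then have "?H #>\<^bsub>\<Gamma>\<^esub> a = ?H" using sg by (simp add: subgroup.rcos_const [OF _ is_group])
  then show ?thesis using sub HC by auto
qed


section \<open>Dihedral groups\<close>

text \<open>
  Words are lists of letters \<open>(g, True)\<close>, standing for the generator \<open>g\<close>, and \<open>(g, False)\<close>,
  standing for its inverse. The group with relators \<open>R\<close> consists of the classes of words modulo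
  insertion and deletion of relators and of trivial words \<open>g g\<inverse>\<close>, \<open>g\<inverse> g\<close>.
\<close>

inductive word_eq :: "('g \<times> bool) list set \<Rightarrow> ('g \<times> bool) list \<Rightarrow> ('g \<times> bool) list \<Rightarrow> bool"
  for R where
  refl: "word_eq R u u"
| sym: "word_eq R u v \<Longrightarrow> word_eq R v u"
| trans: "word_eq R u v \<Longrightarrow> word_eq R v w \<Longrightarrow> word_eq R u w"
| cancel: "word_eq R (u @ [(g, b), (g, \<not> b)] @ v) (u @ v)"
| relator: "r \<in> R \<Longrightarrow> word_eq R (u @ r @ v) (u @ v)"

definition word_class :: "('g \<times> bool) list set \<Rightarrow> ('g \<times> bool) list \<Rightarrow> ('g \<times> bool) list set" where
  "word_class R u = {v. word_eq R u v}"

definition presented_group :: "('g \<times> bool) list set \<Rightarrow> ('g \<times> bool) list set monoid" where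
  "presented_group R = \<lparr> carrier = range (word_class R),
     mult = (\<lambda>X Y. \<Union>u\<in>X. \<Union>v\<in>Y. word_class R (u @ v)),
     one = word_class R [] \<rparr>"

lemma word_eq_append_left: "word_eq R u v \<Longrightarrow> word_eq R (w @ u) (w @ v)"
proof (induct rule: word_eq.induct)
  case (cancel u g b v)
  then show ?case using word_eq.cancel [of R "w @ u" g b v] by simp
next
  case (relator r u v)
  then show ?case using word_eq.relator [of r R "w @ u" v] by simp
qed (auto intro: word_eq.intros(1-3))

lemma word_eq_append_right: "word_eq R u v \<Longrightarrow> word_eq R (u @ w) (v @ w)"
proof (induct rule: word_eq.induct)
  case (cancel u g b v)
  then show ?case using word_eq.cancel [of R u g b "v @ w"] by simp
next
  case (relator r u v)
  then show ?case using word_eq.relator [of r R u "v @ w"] by simp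
qed (auto intro: word_eq.intros(1-3))

lemma word_eq_append: "word_eq R u u' \<Longrightarrow> word_eq R v v' \<Longrightarrow> word_eq R (u @ v) (u' @ v')"
  by (meson word_eq.trans word_eq_append_left word_eq_append_right)

lemma word_class_eq_iff: "word_class R u = word_class R v \<longleftrightarrow> word_eq R u v"
  unfolding word_class_def by (auto intro: word_eq.intros(1-3))

lemma presented_group_mult:
  "word_class R u \<otimes>\<^bsub>presented_group R\<^esub> word_class R v = word_class R (u @ v)"
  unfolding presented_group_def word_class_def
  by (auto intro: word_eq.intros(1-3) word_eq_append)

lemma word_eq_inverse: "word_eq R (map (\<lambda>(g, b). (g, \<not> b)) (rev u) @ u) []"
proof (induct u)
  case (Cons x u)
  obtain g b where x: "x = (g, b)" by (cases x)
  show ?case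
    using word_eq.trans [OF word_eq.cancel [of R "map (\<lambda>(g, b). (g, \<not> b)) (rev u)" g "\<not> b" u] Cons]
    by (simp add: x)
qed (auto intro: word_eq.refl)

lemma group_presented_group: "group (presented_group R)"
proof (rule groupI)
  show "\<exists>y \<in> carrier (presented_group R). y \<otimes>\<^bsub>presented_group R\<^esub> x = \<one>\<^bsub>presented_group R\<^esub>"
    if x: "x \<in> carrier (presented_group R)" for x
  proof -
    obtain u where "x = word_class R u" using x by (auto simp: presented_group_def)
    then have "word_class R (map (\<lambda>(g, b). (g, \<not> b)) (rev u)) \<otimes>\<^bsub>presented_group R\<^esub> x
        = \<one>\<^bsub>presented_group R\<^esub>"
      using word_eq_inverse [of R u] unfolding presented_group_mult [of R] 
      by (simp add: presented_group_mult word_class_eq_iff) (simp add: presented_group_def word_class_eq_iff)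
    then show ?thesis by (auto simp: presented_group_def)
  qed
next
  fix x y z assume "x \<in> carrier (presented_group R)" "y \<in> carrier (presented_group R)"
    "z \<in> carrier (presented_group R)"
  then obtain u v w where "x = word_class R u" "y = word_class R v" "z = word_class R w"
    by (auto simp: presented_group_def)
  then show "x \<otimes>\<^bsub>presented_group R\<^esub> y \<otimes>\<^bsub>presented_group R\<^esub> z
      = x \<otimes>\<^bsub>presented_group R\<^esub> (y \<otimes>\<^bsub>presented_group R\<^esub> z)"
    by (simp add: presented_group_mult)
next
  fix x y assume "x \<in> carrier (presented_group R)" "y \<in> carrier (presented_group R)"
  then obtain u v where "x = word_class R u" "y = word_class R v"
    by (auto simp: presented_group_def)
  then show "x \<otimes>\<^bsub>presented_group R\<^esub> y \<in> carrier (presented_group R)"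
    by (simp add: presented_group_mult) (simp add: presented_group_def)
next
  show "\<one>\<^bsub>presented_group R\<^esub> \<in> carrier (presented_group R)"
    by (simp add: presented_group_def)
next
  fix x assume "x \<in> carrier (presented_group R)"
  then obtain u where "x = word_class R u" by (auto simp: presented_group_def)
  moreover have "\<one>\<^bsub>presented_group R\<^esub> = word_class R []" by (simp add: presented_group_def)
  ultimately show "\<one>\<^bsub>presented_group R\<^esub> \<otimes>\<^bsub>presented_group R\<^esub> x = x"
    by (simp add: presented_group_mult)
qed

datatype dihedral_gen = gen_f | gen_t

definition dihedral_relators :: "nat \<Rightarrow> (dihedral_gen \<times> bool) list set" where
  "dihedral_relators n =
     (let f = (gen_f, True); t = (gen_t, True)
      in {replicate n f, [t, t], [t, f, t, f]})"

text \<open>Of order \<open>2n\<close> for \<open>n \<ge> 1\<close>; \<open>n = 0\<close> would give the infinite dihedral group.\<close>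

definition dihedral_group :: "nat \<Rightarrow> (dihedral_gen \<times> bool) list set monoid" where
  "dihedral_group n = presented_group (dihedral_relators n)"


section \<open>Symmetries of regular polyhedra\<close>

definition flag :: "(real^3) set \<Rightarrow> (real^3) set \<times> (real^3) set \<times> (real^3) set \<Rightarrow> bool" where
  "flag P = (\<lambda>(V, E, F). V face_of P \<and> E face_of P \<and> F face_of P \<and>
     aff_dim V = 0 \<and> aff_dim E = 1 \<and> aff_dim F = 2 \<and> V \<subseteq> E \<and> E \<subseteq> F)"

definition symmetry :: "(real^3) set \<Rightarrow> (real^3 \<Rightarrow> real^3) \<Rightarrow> bool" where
  "symmetry P \<sigma> \<longleftrightarrow> (\<forall>x y. dist (\<sigma> x) (\<sigma> y) = dist x y) \<and> \<sigma> ` P = P"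

definition regular_polyhedron :: "(real^3) set \<Rightarrow> bool" where
  "regular_polyhedron P \<longleftrightarrow> polytope P \<and> aff_dim P = 3 \<and>
     (\<forall>V E F V' E' F'. flag P (V, E, F) \<and> flag P (V', E', F') \<longrightarrow>
        (\<exists>\<sigma>. symmetry P \<sigma> \<and> \<sigma> ` V = V' \<and> \<sigma> ` E = E' \<and> \<sigma> ` F = F'))"

text \<open>
  The groups of symmetries that occur as finite groups of linear fractional transformations are
  the groups of rotations, that is, of orientation-preserving symmetries.
\<close>

definition rotation_group :: "(real^3) set \<Rightarrow> (real^3 \<Rightarrow> real^3) monoid" where
  "rotation_group P = \<lparr> carrier = {\<sigma>. symmetry P \<sigma> \<and>
       (\<exists>Q b. rotation_matrix Q \<and> (\<forall>x. \<sigma> x = Q *v x + b))},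
     mult = (\<circ>), one = id \<rparr>"

end

theory Submission
  imports Defs "Subresultants.Subresultant_Gcd"
    "HOL-Computational_Algebra.Fundamental_Theorem_Algebra"
    "HOL-Analysis.Complex_Transcendental" "HOL-Analysis.Cross3"
begin

text \<open>
  The groups in question act faithfully on the Riemann sphere by linear fractional
  transformations. Suppose that a finite group \<open>\<Gamma>\<close> does, with \<open>g\<close> acting as
  \<open>z \<mapsto> (a\<^sub>g z + b\<^sub>g) / (c\<^sub>g z + d\<^sub>g)\<close>, and put
  \<open>\<Phi>(x,y) = \<Prod>\<^sub>s\<^sub>\<in>\<^sub>S ((c\<^sub>s x + d\<^sub>s) y - (a\<^sub>s x + b\<^sub>s))\<close>.
  The arcs of the digraph of \<open>\<Phi>\<close> that leave \<open>x\<close> end at the points \<open>s x\<close>, and those that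
  enter \<open>y\<close> start at the points \<open>s\<inverse> y\<close>. Only finitely many points have an orbit that meets
  infinity, or have a nontrivial stabiliser; for every other point \<open>u\<close> the map \<open>g \<mapsto> g u\<close>
  identifies the Cayley digraph with the digraph that \<open>\<Phi>\<close> induces on the orbit of \<open>u\<close>.
  No arc joins this orbit to its complement, so components correspond to components.

  The same free orbit shows that \<open>\<Phi>\<close> is standard and that the orbit is nonsingular. At a
  point \<open>v\<close> of it, \<open>\<Phi>(v,y)\<close> has full degree \<open>|S|\<close> and the distinct roots \<open>s v\<close>, so that
  \<open>D(v) \<noteq> 0\<close>; exchanging the variables replaces each transformation by its inverse, so that
  \<open>E(v) \<noteq> 0\<close> follows in the same way; and \<open>L(v) \<noteq> 0\<close> because no \<open>s \<in> S\<close> fixes \<open>v\<close>. The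
  contents are constant because a common root of the coefficients would make some
  \<open>(c\<^sub>s x + d\<^sub>s, a\<^sub>s x + b\<^sub>s)\<close> vanish at a point, against \<open>a\<^sub>s d\<^sub>s - b\<^sub>s c\<^sub>s \<noteq> 0\<close>. This is carried
  out in \<open>cayley_digraph_polynomial\<close>.

  What remains is to produce the actions, as matrices that multiply up to scalars and are
  scalar for the identity element only. For dihedral groups, \<open>f\<close> and \<open>t\<close> become
  \<open>diag(\<omega>, \<omega>\<inverse>)\<close> and the flip of the two coordinates, where \<open>\<omega>\<close> is a primitive root of unity
  of order \<open>2n\<close> (\<open>moebius_group_dihedral\<close>). For rotations of space this is the spin
  representation: the rotation \<open>Q\<close> carries the Pauli matrices \<open>\<sigma>(v)\<close> to \<open>\<sigma>(Q v)\<close>, and the matrix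
  of \<open>Q\<close> is the intertwiner of these two systems, which exists and is unique up to a scalar
  (\<open>moebius_group_rotation_group\<close>).

  Both kinds of groups are nontrivial, so that a set which generates the group is nonempty.
\<close>

text \<open>
  Vectors and matrices are functions on finite index types; the notions for matrices of variable
  size that share their names are hidden.
\<close>

hide_const (open) Matrix.mat Determinant.det
hide_fact (open) Matrix.mat_def Matrix.vec_eq_iff
no_notation vec_index (infixl "$" 100)

section \<open>Bivariate polynomials at a point\<close>

lemma coeff_eval_x: "coeff (eval_x \<Phi> u) i = poly (coeff \<Phi> i) u"
  by (simp add: eval_x_def coeff_map_poly)

lemma poly_eval_x: "poly (eval_x \<Phi> u) v = poly (poly \<Phi> [:v:]) u"
proof (induction \<Phi>)
  case (pCons a \<Phi>)
  have "eval_x (pCons a \<Phi>) u = pCons (poly a u) (eval_x \<Phi> u)"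
    by (rule poly_eqI) (simp add: coeff_eval_x coeff_pCons split: nat.split)
  then show ?case using pCons by simp
qed (simp add: eval_x_def)

lemma eval_x_mult: "eval_x (\<Phi> * \<Psi>) u = eval_x \<Phi> u * eval_x \<Psi> u"
  by (rule poly_eqI) (simp add: coeff_eval_x coeff_mult poly_sum)

lemma eval_x_1: "eval_x 1 u = 1"
  by (rule poly_eqI) (simp add: coeff_eval_x)

lemma eval_x_prod: "eval_x (\<Prod>i\<in>I. \<Phi> i) u = (\<Prod>i\<in>I. eval_x (\<Phi> i) u)"
  by (induction I rule: infinite_finite_induct) (simp_all add: eval_x_1 eval_x_mult)

lemma swap_vars_mult: "swap_vars (\<Phi> * \<Psi>) = swap_vars \<Phi> * swap_vars \<Psi>"
proof (intro poly_eqI)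
  fix i j
  have "coeff (coeff (swap_vars (\<Phi> * \<Psi>)) j) i =
      (\<Sum>k\<le>i. \<Sum>l\<le>j. coeff (coeff \<Phi> k) l * coeff (coeff \<Psi> (i - k)) (j - l))"
    by (simp add: coeff_swap_vars coeff_mult coeff_sum)
  also have "\<dots> = (\<Sum>l\<le>j. \<Sum>k\<le>i. coeff (coeff \<Phi> k) l * coeff (coeff \<Psi> (i - k)) (j - l))"
    by (rule sum.swap)
  also have "\<dots> = coeff (coeff (swap_vars \<Phi> * swap_vars \<Psi>) j) i"
    by (simp add: coeff_swap_vars coeff_mult coeff_sum)
  finally show "coeff (coeff (swap_vars (\<Phi> * \<Psi>)) j) i =
      coeff (coeff (swap_vars \<Phi> * swap_vars \<Psi>) j) i" .
qed

lemma swap_vars_1: "swap_vars 1 = 1"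
  by (intro poly_eqI) (auto simp: coeff_swap_vars coeff_1)

lemma swap_vars_prod: "swap_vars (\<Prod>i\<in>I. \<Phi> i) = (\<Prod>i\<in>I. swap_vars (\<Phi> i))"
  by (induction I rule: infinite_finite_induct) (simp_all add: swap_vars_1 swap_vars_mult)

text \<open>
  A root of the content is a common root of all coefficients.
\<close>

lemma degree_content_eq_0:
  assumes "\<And>u. eval_x \<Phi> u \<noteq> 0"
  shows "degree (content \<Phi>) = 0"
proof (rule ccontr)
  assume "degree (content \<Phi>) \<noteq> 0"
  then obtain u where u: "poly (content \<Phi>) u = 0"
    using fundamental_theorem_of_algebra [of "content \<Phi>"] by (auto simp: constant_degree)
  have "coeff (eval_x \<Phi> u) i = 0" for i
    using content_dvd_coeff [of \<Phi> i] u
    by (metis coeff_eval_x dvd_trans poly_eq_0_iff_dvd)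
  then show False using assms [of u] by (simp add: poly_eq_iff)
qed

lemma poly_L_poly: "poly (L_poly \<Phi>) u = poly (eval_x \<Phi> u) u"
proof -
  have "poly (poly \<Phi> [:0, 1:]) u = poly (poly \<Phi> [:u:]) u"
    by (induction \<Phi>) simp_all
  then show ?thesis by (simp add: L_poly_def poly_eval_x)
qed

lemma resultant_pderiv_neq_0:
  fixes p :: "complex poly"
  assumes "rsquarefree p"
  shows "resultant p (pderiv p) \<noteq> 0"
proof
  assume "resultant p (pderiv p) = 0"
  then have "degree (gcd p (pderiv p)) \<noteq> 0" by (simp add: resultant_0_gcd)
  then obtain z where "poly (gcd p (pderiv p)) z = 0"
    using fundamental_theorem_of_algebra [of "gcd p (pderiv p)"] by (auto simp: constant_degree)
  then have "poly p z = 0" "poly (pderiv p) z = 0"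
    unfolding poly_eq_0_iff_dvd by (metis dvd_trans gcd_dvd1, metis dvd_trans gcd_dvd2)
  then show False using assms by (simp add: rsquarefree_roots)
qed

text \<open>
  A resultant is a determinant whose size depends on the two degrees, so it commutes with the
  specialisation \<open>x := u\<close> as soon as the degree in \<open>y\<close> does not drop at \<open>u\<close>.
\<close>

lemma D_poly_neq_0_at:
  assumes "degree (eval_x \<Phi> u) = degree \<Phi>" and "rsquarefree (eval_x \<Phi> u)"
  shows "poly (D_poly \<Phi>) u \<noteq> 0"
proof -
  have pd: "eval_x (pderiv \<Phi>) u = pderiv (eval_x \<Phi> u)"
    by (rule poly_eqI) (simp add: coeff_eval_x coeff_pderiv poly_of_nat)
  have "poly (resultant \<Phi> (pderiv \<Phi>)) u = resultant (eval_x \<Phi> u) (eval_x (pderiv \<Phi>) u)"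
    using assms(1) pd
    by (simp add: eval_x_def degree_pderiv flip: poly_hom.resultant_map_poly)
  then show ?thesis using resultant_pderiv_neq_0 [OF assms(2)] pd by (simp add: D_poly_def)
qed

section \<open>Products of graphs of linear fractional transformations\<close>

definition mob_num :: "complex^2^2 \<Rightarrow> complex \<Rightarrow> complex" where
  "mob_num A u = A$1$1 * u + A$1$2"

definition mob_den :: "complex^2^2 \<Rightarrow> complex \<Rightarrow> complex" where
  "mob_den A u = A$2$1 * u + A$2$2"

definition mob :: "complex^2^2 \<Rightarrow> complex \<Rightarrow> complex" where
  "mob A u = mob_num A u / mob_den A u"

text \<open>
  The curve \<open>(c x + d) y = a x + b\<close>, which is the graph of the transformation with matrix
  \<open>((a, b), (c, d))\<close>.
\<close>

definition graph_poly :: "complex^2^2 \<Rightarrow> bipoly" where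
  "graph_poly A = [:- [:A$1$2, A$1$1:], [:A$2$2, A$2$1:]:]"

definition graphs_poly :: "('i \<Rightarrow> complex^2^2) \<Rightarrow> 'i set \<Rightarrow> bipoly" where
  "graphs_poly A I = (\<Prod>i\<in>I. graph_poly (A i))"

lemma eval_x_graph_poly: "eval_x (graph_poly A) u = [:- mob_num A u, mob_den A u:]"
  by (rule poly_eqI)
    (simp add: coeff_eval_x graph_poly_def mob_num_def mob_den_def coeff_pCons algebra_simps
      split: nat.split)

lemma eval_x_graphs_poly:
  "eval_x (graphs_poly A I) u = (\<Prod>i\<in>I. [:- mob_num (A i) u, mob_den (A i) u:])"
  by (simp add: graphs_poly_def eval_x_prod eval_x_graph_poly)

text \<open>
  Otherwise \<open>(u, 1)\<close> would be in the kernel of the matrix.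
\<close>

lemma mob_num_den_not_both_0:
  assumes "det A \<noteq> 0" and "mob_den A u = 0"
  shows "mob_num A u \<noteq> 0"
proof
  assume "mob_num A u = 0"
  then have "A$1$2 = - A$1$1 * u" "A$2$2 = - A$2$1 * u"
    using assms(2) by (auto simp: mob_num_def mob_den_def eq_neg_iff_add_eq_0 add.commute)
  then have "det A = 0" by (simp add: det_2)
  then show False using assms(1) by simp
qed

lemma eval_x_graphs_poly_neq_0:
  assumes "finite I" and "\<And>i. i \<in> I \<Longrightarrow> det (A i) \<noteq> 0"
  shows "eval_x (graphs_poly A I) u \<noteq> 0"
  using assms mob_num_den_not_both_0 by (fastforce simp: eval_x_graphs_poly)

text \<open>
  Minus the adjugate. As a transformation it is the inverse of \<open>A\<close>; the sign and the missing
  factor \<open>1 / det A\<close> make the exchange of variables in \<open>graph_poly\<close> an exact identity.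
\<close>

definition co_mat :: "complex^2^2 \<Rightarrow> complex^2^2" where
  "co_mat A = vector [vector [- A$2$2, A$1$2], vector [A$2$1, - A$1$1]]"

lemma co_mat_nth [simp]:
  "co_mat A $ 1 $ 1 = - A$2$2" "co_mat A $ 1 $ 2 = A$1$2"
  "co_mat A $ 2 $ 1 = A$2$1" "co_mat A $ 2 $ 2 = - A$1$1"
  by (simp_all add: co_mat_def vector_2)

lemma det_co_mat [simp]: "det (co_mat A) = det A"
  by (simp add: det_2)

lemma swap_vars_graph_poly: "swap_vars (graph_poly A) = graph_poly (co_mat A)"
  by (intro poly_eqI)
    (auto simp: coeff_swap_vars graph_poly_def coeff_pCons split: nat.split)

lemma swap_vars_graphs_poly: "swap_vars (graphs_poly A I) = graphs_poly (\<lambda>i. co_mat (A i)) I"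
  by (simp add: graphs_poly_def swap_vars_prod swap_vars_graph_poly)

text \<open>
  The images of \<open>u\<close> under the members of the family are finite and distinct. This is what makes
  the polynomial in \<open>y\<close> that the product of the graphs has at \<open>x = u\<close> of full degree and
  squarefree.
\<close>

definition separating :: "('i \<Rightarrow> complex^2^2) \<Rightarrow> 'i set \<Rightarrow> complex \<Rightarrow> bool" where
  "separating A I u \<longleftrightarrow> (\<forall>i\<in>I. mob_den (A i) u \<noteq> 0) \<and> inj_on (\<lambda>i. mob (A i) u) I"

lemma eval_x_graphs_poly_separating:
  assumes "separating A I u"
  shows "eval_x (graphs_poly A I) u =
    smult (\<Prod>i\<in>I. mob_den (A i) u) (\<Prod>i\<in>I. [:- mob (A i) u, 1:])"
proof -
  have "[:- mob_num (A i) u, mob_den (A i) u:] =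
      smult (mob_den (A i) u) [:- mob (A i) u, 1:]" if "i \<in> I" for i
    using assms that by (simp add: separating_def mob_def)
  then have "eval_x (graphs_poly A I) u =
      (\<Prod>i\<in>I. smult (mob_den (A i) u) [:- mob (A i) u, 1:])"
    unfolding eval_x_graphs_poly by (intro prod.cong) auto
  then show ?thesis by (simp only: prod_smult)
qed

lemma order_prod_linear:
  fixes m :: "'i \<Rightarrow> 'a::idom"
  assumes "finite I" and "inj_on m I"
  shows "order w (\<Prod>i\<in>I. [:- m i, 1:]) = (if w \<in> m ` I then 1 else 0)"
  using assms
proof (induction rule: finite_induct)
  case (insert i I)
  have "(\<Prod>j\<in>insert i I. [:- m j, 1:]) \<noteq> 0"
    using insert by (subst prod_zero_iff) auto
  then have "order w (\<Prod>j\<in>insert i I. [:- m j, 1:]) =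
      order w [:- m i, 1:] + order w (\<Prod>j\<in>I. [:- m j, 1:])"
    using insert by (simp add: order_mult del: mult_pCons_left)
  moreover have "order w [:- m i, 1:] = (if w = m i then 1 else 0)"
    using order_power_n_n [of "m i" 1] by (auto intro!: order_0I)
  ultimately show ?case using insert by auto
qed (simp add: order_1_eq_0)

lemma order_separating:
  assumes "finite I" and "separating A I u"
  shows "order v (eval_x (graphs_poly A I) u) = (if \<exists>i\<in>I. v = mob (A i) u then 1 else 0)"
proof -
  have "(\<Prod>i\<in>I. mob_den (A i) u) \<noteq> 0" using assms by (auto simp: separating_def)
  then have "order v (eval_x (graphs_poly A I) u) = order v (\<Prod>i\<in>I. [:- mob (A i) u, 1:])"
    by (simp add: eval_x_graphs_poly_separating [OF assms(2)] order_smult)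
  also have "\<dots> = (if v \<in> (\<lambda>i. mob (A i) u) ` I then 1 else 0)"
    using assms by (intro order_prod_linear) (auto simp: separating_def)
  finally show ?thesis by auto
qed

lemma degree_graphs_poly:
  assumes "finite I" and "separating A I u"
  shows "degree (eval_x (graphs_poly A I) u) = card I" "degree (graphs_poly A I) = card I"
proof -
  have "(\<Prod>i\<in>I. mob_den (A i) u) \<noteq> 0" using assms by (auto simp: separating_def)
  then show 1: "degree (eval_x (graphs_poly A I) u) = card I"
    by (simp add: eval_x_graphs_poly_separating [OF assms(2)] degree_prod_sum_eq)
  have "degree (graphs_poly A I) \<le> (\<Sum>i\<in>I. degree (graph_poly (A i)))"
    unfolding graphs_poly_def using degree_prod_sum_le [OF assms(1)] by (simp add: comp_def)
  also have "\<dots> \<le> (\<Sum>i\<in>I. 1)"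
    by (rule sum_mono) (auto simp: graph_poly_def)
  finally have "degree (graphs_poly A I) \<le> card I" by simp
  moreover have "degree (eval_x (graphs_poly A I) u) \<le> degree (graphs_poly A I)"
    unfolding eval_x_def by (rule degree_map_poly_le)
  ultimately show "degree (graphs_poly A I) = card I" using 1 by simp
qed

lemma D_poly_graphs_poly:
  assumes "finite I" and "\<And>i. i \<in> I \<Longrightarrow> det (A i) \<noteq> 0" and "separating A I u"
  shows "poly (D_poly (graphs_poly A I)) u \<noteq> 0"
proof (rule D_poly_neq_0_at)
  show "degree (eval_x (graphs_poly A I) u) = degree (graphs_poly A I)"
    using degree_graphs_poly [OF assms(1,3)] by simp
  show "rsquarefree (eval_x (graphs_poly A I) u)"
    using eval_x_graphs_poly_neq_0 [OF assms(1,2)] order_separating [OF assms(1,3)]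
    by (auto simp: rsquarefree_def)
qed

lemma
  assumes "finite I" and det: "\<And>i. i \<in> I \<Longrightarrow> det (A i) \<noteq> 0"
    and sep: "separating A I u" "separating (\<lambda>i. co_mat (A i)) I u"
    and nofix: "\<And>i. i \<in> I \<Longrightarrow> mob (A i) u \<noteq> u"
  shows not_singular_graphs_poly: "\<not> singular_vertex (graphs_poly A I) u"
    and standard_graphs_poly: "I \<noteq> {} \<Longrightarrow> standard_poly (graphs_poly A I)"
proof -
  let ?\<Phi> = "graphs_poly A I"
  have D: "poly (D_poly ?\<Phi>) u \<noteq> 0"
    by (rule D_poly_graphs_poly [OF assms(1) det sep(1)])
  have E: "poly (E_poly ?\<Phi>) u \<noteq> 0"
    using D_poly_graphs_poly [OF assms(1) _ sep(2)] det
    by (simp add: E_poly_def swap_vars_graphs_poly flip: D_poly_def)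
  have "order u (eval_x ?\<Phi> u) = 0"
    using order_separating [OF assms(1) sep(1), of u] nofix by metis
  then have L: "poly (L_poly ?\<Phi>) u \<noteq> 0"
    using eval_x_graphs_poly_neq_0 [of I A u, OF assms(1) det] by (simp add: poly_L_poly order_root)
  show "\<not> singular_vertex ?\<Phi> u" using D E L by (simp add: singular_vertex_def)
  assume "I \<noteq> {}"
  then have "degree ?\<Phi> \<noteq> 0"
    using degree_graphs_poly(2) [OF assms(1) sep(1)] assms(1) by auto
  then have "\<nexists>c. ?\<Phi> = [:[:c:]:]" by auto
  moreover have "degree (content ?\<Phi>) = 0"
    by (intro degree_content_eq_0 eval_x_graphs_poly_neq_0 assms(1) det)
  moreover have "degree (content (swap_vars ?\<Phi>)) = 0"
    unfolding swap_vars_graphs_poly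
    by (intro degree_content_eq_0 eval_x_graphs_poly_neq_0 assms(1)) (simp add: det)
  ultimately show "standard_poly ?\<Phi>" using D E L by (auto simp: standard_poly_def)
qed

lemma arc_mult_separating:
  assumes "finite I" and "\<And>i. i \<in> I \<Longrightarrow> det (A i) \<noteq> 0" and "separating A I u"
  shows "arc_mult (graphs_poly A I) u v = (if \<exists>i\<in>I. v = mob (A i) u then 1 else 0)"
  using order_separating [OF assms(1,3)] eval_x_graphs_poly_neq_0 [OF assms(1,2)]
  by (simp add: arc_mult_def)

lemma arc_mult_posD:
  assumes "finite I" and "\<And>i. i \<in> I \<Longrightarrow> det (A i) \<noteq> 0" and "arc_mult (graphs_poly A I) u v > 0"
  shows "\<exists>i\<in>I. mob_num (A i) u = v * mob_den (A i) u"
proof -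
  have "poly (eval_x (graphs_poly A I) u) v = 0"
    using assms(3) eval_x_graphs_poly_neq_0 [of I A u, OF assms(1,2)]
    by (simp add: arc_mult_def order_root split: if_splits)
  then obtain i where "i \<in> I" "poly [:- mob_num (A i) u, mob_den (A i) u:] v = 0"
    unfolding eval_x_graphs_poly poly_prod using assms(1) by (auto simp: prod_zero_iff)
  then show ?thesis by (intro bexI [of _ i]) simp_all
qed

section \<open>Cayley digraphs inside digraphs of polynomials\<close>

definition weak_adj :: "('a, 'b) pre_digraph \<Rightarrow> 'a \<Rightarrow> 'a \<Rightarrow> bool" where
  "weak_adj G x y \<longleftrightarrow> (\<exists>e\<in>arcs G. (tail G e = x \<and> head G e = y) \<or> (tail G e = y \<and> head G e = x))"

text \<open>
  Weak components become the classes of a reflexive transitive closure, which an injective map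
  that respects adjacency transports by a plain induction.
\<close>

lemma component_verts_eq:
  assumes "wf_digraph G" and "u \<in> verts G"
  shows "component_verts G u = {v. (weak_adj G)\<^sup>*\<^sup>* u v}"
proof -
  interpret wf_digraph G by fact
  interpret M: pair_wf_digraph "mk_symmetric G" by (rule wellformed_mk_symmetric)
  have adj: "x \<rightarrow>\<^bsub>with_proj (mk_symmetric G)\<^esub> y \<longleftrightarrow> weak_adj G x y" for x y
    by (auto simp: mk_symmetric_def arcs_ends_conv weak_adj_def)
  show ?thesis
  proof (intro equalityI subsetI)
    fix v assume "v \<in> component_verts G u"
    then have "u \<rightarrow>\<^sup>*\<^bsub>with_proj (mk_symmetric G)\<^esub> v" by (simp add: component_verts_def)
    then have "(weak_adj G)\<^sup>*\<^sup>* u v"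
    proof (induct rule: M.reachable_induct)
      case (step x y)
      then have "weak_adj G x y" using adj by simp
      then show ?case using step(3) by (rule rtranclp.rtrancl_into_rtrancl [rotated])
    qed simp
    then show "v \<in> {v. (weak_adj G)\<^sup>*\<^sup>* u v}" by simp
  next
    fix v assume "v \<in> {v. (weak_adj G)\<^sup>*\<^sup>* u v}"
    then have "(weak_adj G)\<^sup>*\<^sup>* u v" by simp
    then have "u \<rightarrow>\<^sup>*\<^bsub>with_proj (mk_symmetric G)\<^esub> v"
    proof (induct rule: rtranclp_induct)
      case base
      then show ?case using M.reachable_refl [of u] assms(2) by simp
    next
      case (step x y)
      then have "x \<rightarrow>\<^bsub>with_proj (mk_symmetric G)\<^esub> y" using adj by simp
      then show ?case using M.reachable_adj_trans [OF step(3)] by simp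
    qed
    then show "v \<in> component_verts G u" by (simp add: component_verts_def)
  qed
qed

lemma wf_poly_digraph: "wf_digraph (poly_digraph \<Phi>)"
  by unfold_locales (auto simp: poly_digraph_def)

lemma weak_adj_poly_digraph:
  "weak_adj (poly_digraph \<Phi>) x y \<longleftrightarrow> arc_mult \<Phi> x y > 0 \<or> arc_mult \<Phi> y x > 0"
  by (auto simp: weak_adj_def poly_digraph_def)

lemma component_verts_poly_digraph:
  "component_verts (poly_digraph \<Phi>) u = {v. (weak_adj (poly_digraph \<Phi>))\<^sup>*\<^sup>* u v}"
  by (intro component_verts_eq wf_poly_digraph) (simp add: poly_digraph_def)

context group
begin

lemma wf_cayley_digraph:
  assumes "S \<subseteq> carrier G"
  shows "wf_digraph (cayley_digraph G S)"
  using assms by unfold_locales (auto simp: cayley_digraph_def)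

lemma weak_adj_cayley_digraph:
  "weak_adj (cayley_digraph G S) x y \<longleftrightarrow>
     (x \<in> carrier G \<and> (\<exists>s\<in>S. y = s \<otimes> x)) \<or> (y \<in> carrier G \<and> (\<exists>s\<in>S. x = s \<otimes> y))"
  by (auto simp: weak_adj_def cayley_digraph_def)

lemma weak_adj_cayley_in_carrier:
  assumes "S \<subseteq> carrier G" and "(weak_adj (cayley_digraph G S))\<^sup>*\<^sup>* u v" and "u \<in> carrier G"
  shows "v \<in> carrier G"
  using assms(2,3) assms(1)
  by (induction rule: rtranclp_induct) (auto simp: weak_adj_cayley_digraph)

lemma component_verts_cayley:
  assumes "S \<subseteq> carrier G" and "u \<in> carrier G"
  shows "component_verts (cayley_digraph G S) u = {v. (weak_adj (cayley_digraph G S))\<^sup>*\<^sup>* u v}"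
  using assms by (intro component_verts_eq wf_cayley_digraph) (simp_all add: cayley_digraph_def)

lemma component_verts_cayley_subset:
  assumes "S \<subseteq> carrier G" and "u \<in> carrier G"
  shows "component_verts (cayley_digraph G S) u \<subseteq> carrier G"
  using assms weak_adj_cayley_in_carrier by (auto simp: component_verts_cayley)

text \<open>
  Walking from \<open>x\<close> to \<open>h x\<close> spells out \<open>h\<close> as a product of generators and their inverses,
  read from the right; a factor \<open>s\<inverse>\<close> traverses an arc backwards.
\<close>

lemma component_verts_cayley_generate:
  assumes S: "S \<subseteq> carrier G" and gen: "generate G S = carrier G" and u: "u \<in> carrier G"
  shows "component_verts (cayley_digraph G S) u = carrier G"
proof (intro equalityI component_verts_cayley_subset S u subsetI)
  fix v assume v: "v \<in> carrier G"
  let ?R = "(weak_adj (cayley_digraph G S))\<^sup>*\<^sup>*"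
  have "?R x (h \<otimes> x)" if "h \<in> generate G S" "x \<in> carrier G" for h x
    using that
  proof (induction arbitrary: x)
    case (incl h)
    then show ?case by (intro r_into_rtranclp) (auto simp: weak_adj_cayley_digraph)
  next
    case (inv h)
    then have "h \<in> carrier G" using S by auto
    then have "x = h \<otimes> (inv h \<otimes> x)" using inv by (simp add: m_assoc [symmetric])
    then show ?case using inv \<open>h \<in> carrier G\<close>
      by (intro r_into_rtranclp) (auto simp: weak_adj_cayley_digraph)
  next
    case (eng h1 h2)
    then have "h1 \<in> carrier G" "h2 \<in> carrier G" using gen by auto
    then show ?case using eng.IH(2) [of x] eng.IH(1) [of "h2 \<otimes> x"] eng.prems
      by (simp add: m_assoc)
  qed simp
  moreover have "v \<otimes> inv u \<in> generate G S" using gen u v by simp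
  ultimately have "?R u (v \<otimes> inv u \<otimes> u)" using u by simp
  then show "v \<in> component_verts (cayley_digraph G S) u"
    using S u v by (simp add: component_verts_cayley m_assoc)
qed

lemma cayley_digraph_induce_carrier:
  assumes "S \<subseteq> carrier G"
  shows "cayley_digraph G S \<restriction> carrier G = cayley_digraph G S"
  using assms by (auto simp: induce_subgraph_def cayley_digraph_def)

lemma regular_component_cayley:
  assumes S: "S \<subseteq> carrier G" "finite S" and u: "u \<in> carrier G"
  shows "regular_digraph (card S) (component (cayley_digraph G S) u)"
proof -
  let ?C = "cayley_digraph G S"
  let ?W = "component_verts ?C u"
  interpret wf_digraph ?C by (rule wf_cayley_digraph [OF S(1)])
  have W: "?W = {v. (weak_adj ?C)\<^sup>*\<^sup>* u v}" by (rule component_verts_cayley [OF S(1) u])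
  have WC: "?W \<subseteq> carrier G" by (rule component_verts_cayley_subset [OF S(1) u])
  have wf: "wf_digraph (?C \<restriction> ?W)" by (rule wellformed_induce_subgraph)
  have step: "y \<in> ?W" if "x \<in> ?W" "weak_adj ?C x y" for x y
    using that unfolding W by auto
  have out: "out_arcs (?C \<restriction> ?W) v = (\<lambda>s. (v, s \<otimes> v)) ` S" if v: "v \<in> ?W" for v
  proof -
    have "s \<otimes> v \<in> ?W" if "s \<in> S" for s
      using step [OF v] that v WC by (auto simp: weak_adj_cayley_digraph)
    then show ?thesis using v WC by (auto simp: out_arcs_def cayley_digraph_def)
  qed
  have in': "in_arcs (?C \<restriction> ?W) v = (\<lambda>s. (inv s \<otimes> v, v)) ` S" if v: "v \<in> ?W" for v
  proof -
    have vC: "v \<in> carrier G" using v WC by auto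
    have eq: "s \<otimes> (inv s \<otimes> v) = v" if "s \<in> S" for s
      using that S vC by (subst m_assoc [symmetric]) auto
    have mem: "inv s \<otimes> v \<in> ?W" if "s \<in> S" for s
      using that S vC eq [OF that]
      by (intro step [OF v]) (auto simp: weak_adj_cayley_digraph intro!: disjI2 bexI [of _ s])
    have inve: "x = inv s \<otimes> (s \<otimes> x)" if "s \<in> S" "x \<in> carrier G" for s x
      using that S by (subst m_assoc [symmetric]) auto
    show ?thesis
    proof (intro equalityI subsetI)
      fix e assume "e \<in> in_arcs (?C \<restriction> ?W) v"
      then obtain x s where "e = (x, s \<otimes> x)" "s \<otimes> x = v" "s \<in> S" "x \<in> carrier G"
        by (auto simp: in_arcs_def cayley_digraph_def)
      then show "e \<in> (\<lambda>s. (inv s \<otimes> v, v)) ` S" using inve by force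
    next
      fix e assume "e \<in> (\<lambda>s. (inv s \<otimes> v, v)) ` S"
      then obtain s where s: "s \<in> S" "e = (inv s \<otimes> v, v)" by auto
      then have "\<exists>x s'. e = (x, s' \<otimes> x) \<and> x \<in> carrier G \<and> s' \<in> S"
        using eq S vC by (intro exI [of _ "inv s \<otimes> v"] exI [of _ s]) auto
      then show "e \<in> in_arcs (?C \<restriction> ?W) v"
        using s mem [OF s(1)] v by (auto simp: in_arcs_def cayley_digraph_def)
    qed
  qed
  have inj: "inj_on (\<lambda>s. (v, s \<otimes> v)) S" "inj_on (\<lambda>s. (inv s \<otimes> v, v)) S" if v: "v \<in> ?W" for v
  proof -
    have vC: "v \<in> carrier G" using v WC by auto
    show "inj_on (\<lambda>s. (v, s \<otimes> v)) S" using vC S by (intro inj_onI) (simp add: subset_iff)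
    show "inj_on (\<lambda>s. (inv s \<otimes> v, v)) S"
    proof (rule inj_onI)
      fix s t assume st: "s \<in> S" "t \<in> S" "(inv s \<otimes> v, v) = (inv t \<otimes> v, v)"
      then have "s \<in> carrier G" "t \<in> carrier G" using S by auto
      then show "s = t" using st(3) vC inv_inv by (metis inv_closed prod.inject right_cancel)
    qed
  qed
  have "finite (in_arcs (?C \<restriction> ?W) v) \<and> finite (out_arcs (?C \<restriction> ?W) v) \<and>
      card (in_arcs (?C \<restriction> ?W) v) = card S \<and> card (out_arcs (?C \<restriction> ?W) v) = card S"
    if "v \<in> ?W" for v
    unfolding out [OF that] in' [OF that] using inj [OF that] S(2) by (simp add: card_image)
  then show ?thesis
    using wf unfolding component_def regular_digraph_def in_degree_def out_degree_def
    by (simp only: induce_subgraph_verts) blast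
qed

text \<open>
  The statement covers every set \<open>W\<close> of vertices because it is needed both for the whole
  group and for a single component.
\<close>

lemma cayley_iso_poly_digraph:
  assumes S: "S \<subseteq> carrier G" and W: "W \<subseteq> carrier G" and inj: "inj_on \<phi> (carrier G)"
    and arcs: "\<And>x y. x \<in> carrier G \<Longrightarrow> y \<in> carrier G \<Longrightarrow>
      arc_mult \<Phi> (\<phi> x) (\<phi> y) = (if \<exists>s\<in>S. y = s \<otimes> x then 1 else 0)"
  shows "digraph_iso (cayley_digraph G S \<restriction> W) (poly_digraph \<Phi> \<restriction> \<phi> ` W)"
proof -
  let ?C = "cayley_digraph G S"
  interpret wf_digraph ?C by (rule wf_cayley_digraph [OF S(1)])
  define F where "F = \<lparr>iso_verts = \<phi>, iso_arcs = (\<lambda>(x, y). (\<phi> x, \<phi> y, 0::nat)),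
     iso_head = (\<lambda>(u, v, i). v), iso_tail = (\<lambda>(u, v, i). u)\<rparr>"
  have injW: "inj_on \<phi> W" using inj W by (rule inj_on_subset)
  have arcsW: "arcs (?C \<restriction> W) = {(x, y). x \<in> W \<and> y \<in> W \<and> (\<exists>s\<in>S. y = s \<otimes> x)}"
    using W by (auto simp: cayley_digraph_def)
  have A: "arcs (poly_digraph \<Phi> \<restriction> \<phi> ` W) = iso_arcs F ` arcs (?C \<restriction> W)"
  proof (intro equalityI subsetI)
    fix e assume "e \<in> arcs (poly_digraph \<Phi> \<restriction> \<phi> ` W)"
    then obtain x y i where e: "e = (\<phi> x, \<phi> y, i)" "x \<in> W" "y \<in> W" "i < arc_mult \<Phi> (\<phi> x) (\<phi> y)"
      by (auto simp: poly_digraph_def)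
    then have "i = 0 \<and> (\<exists>s\<in>S. y = s \<otimes> x)" using arcs [of x y] W by (simp add: subset_iff split: if_splits)
    then have "(x, y) \<in> arcs (?C \<restriction> W)" "e = iso_arcs F (x, y)"
      unfolding arcsW using e by (auto simp: F_def)
    then show "e \<in> iso_arcs F ` arcs (?C \<restriction> W)" by blast
  next
    fix e assume "e \<in> iso_arcs F ` arcs (?C \<restriction> W)"
    then obtain x y where xy: "e = (\<phi> x, \<phi> y, 0)" "x \<in> W" "y \<in> W" "\<exists>s\<in>S. y = s \<otimes> x"
      unfolding arcsW by (auto simp: F_def)
    then have "arc_mult \<Phi> (\<phi> x) (\<phi> y) = 1" using arcs [of x y] W by (simp add: subset_iff)
    then show "e \<in> arcs (poly_digraph \<Phi> \<restriction> \<phi> ` W)" using xy by (simp add: poly_digraph_def)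
  qed
  have "poly_digraph \<Phi> \<restriction> \<phi> ` W = app_iso F (?C \<restriction> W)"
    using A by (simp add: app_iso_def F_def) (simp add: poly_digraph_def induce_subgraph_def)
  moreover have "pre_digraph.digraph_isomorphism (?C \<restriction> W) F"
    using injW wellformed_induce_subgraph [of W] unfolding pre_digraph.digraph_isomorphism_def arcsW
    by (auto simp: F_def inj_on_def cayley_digraph_def)
  ultimately show ?thesis unfolding digraph_iso_def by blast
qed

text \<open>
  The closure condition says that no arc leaves or enters the image of the group, so that a walk
  that starts in it can be pulled back step by step.
\<close>

lemma component_verts_image:
  assumes S: "S \<subseteq> carrier G" and inj: "inj_on \<phi> (carrier G)"
    and arcs: "\<And>x y. x \<in> carrier G \<Longrightarrow> y \<in> carrier G \<Longrightarrow>
      arc_mult \<Phi> (\<phi> x) (\<phi> y) = (if \<exists>s\<in>S. y = s \<otimes> x then 1 else 0)"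
    and closed: "\<And>x w. x \<in> carrier G \<Longrightarrow> arc_mult \<Phi> (\<phi> x) w > 0 \<or> arc_mult \<Phi> w (\<phi> x) > 0 \<Longrightarrow>
      w \<in> \<phi> ` carrier G"
    and x: "x \<in> carrier G"
  shows "component_verts (poly_digraph \<Phi>) (\<phi> x) = \<phi> ` component_verts (cayley_digraph G S) x"
proof -
  let ?R = "weak_adj (cayley_digraph G S)" and ?P = "weak_adj (poly_digraph \<Phi>)"
  have adj: "?P (\<phi> y) (\<phi> z) \<longleftrightarrow> ?R y z" if "y \<in> carrier G" "z \<in> carrier G" for y z
    using that by (auto simp: weak_adj_poly_digraph weak_adj_cayley_digraph arcs)
  have "\<exists>y\<in>carrier G. w = \<phi> y \<and> ?R\<^sup>*\<^sup>* x y" if "?P\<^sup>*\<^sup>* (\<phi> x) w" for w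
    using that
  proof (induction rule: rtranclp_induct)
    case base
    then show ?case using x by auto
  next
    case (step w w')
    then obtain y where y: "y \<in> carrier G" "w = \<phi> y" "?R\<^sup>*\<^sup>* x y" by auto
    then obtain z where z: "z \<in> carrier G" "w' = \<phi> z"
      using closed [of y w'] step(2) by (auto simp: weak_adj_poly_digraph)
    have "?R y z" using adj [OF y(1) z(1)] step(2) y(2) z(2) by simp
    with y(3) have "?R\<^sup>*\<^sup>* x z" by (rule rtranclp.rtrancl_into_rtrancl)
    then show ?case using z by blast
  qed
  moreover have "?P\<^sup>*\<^sup>* (\<phi> x) (\<phi> y)" if "?R\<^sup>*\<^sup>* x y" for y
    using that
  proof (induction rule: rtranclp_induct)
    case (step y z)
    then have "y \<in> carrier G" "z \<in> carrier G"
      using weak_adj_cayley_in_carrier [OF S _ x] by (auto intro: rtranclp.rtrancl_into_rtrancl)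
    then have "?P (\<phi> y) (\<phi> z)" using adj step(2) by simp
    with step(3) show ?case by (rule rtranclp.rtrancl_into_rtrancl)
  qed simp
  ultimately have "{w. ?P\<^sup>*\<^sup>* (\<phi> x) w} = \<phi> ` {y. ?R\<^sup>*\<^sup>* x y}" by blast
  then show ?thesis
    by (simp add: component_verts_cayley [OF S x] component_verts_poly_digraph)
qed

end

section \<open>Finite groups of linear fractional transformations\<close>

lemma mob_co_mat:
  assumes "det A \<noteq> 0" and "mob_den A u \<noteq> 0"
  shows "mob_den (co_mat A) (mob A u) \<noteq> 0" and "mob (co_mat A) (mob A u) = u"
proof -
  have den: "mob_den (co_mat A) (mob A u) = - det A / mob_den A u"
    using assms(2) unfolding mob_def mob_num_def mob_den_def
    by (simp add: det_2 field_simps)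
  then show "mob_den (co_mat A) (mob A u) \<noteq> 0" using assms by simp
  have "mob_num (co_mat A) (mob A u) = - det A / mob_den A u * u"
    using assms(2) unfolding mob_def mob_num_def mob_den_def
    by (simp add: det_2 field_simps)
  then show "mob (co_mat A) (mob A u) = u" using den assms by (simp add: mob_def)
qed

lemma mat_mult_nth: "(mat c ** (A :: complex^2^2)) $ i $ j = c * A $ i $ j"
  using exhaust_2 [of i]
  by (auto simp: matrix_matrix_mult_def mat_def sum_2)

lemma mat_mult_right: "(M :: complex^2^2) ** mat c = mat c ** M"
  by (auto simp: vec_eq_iff mat_mult_nth matrix_matrix_mult_def mat_def sum_2 forall_2)

text \<open>
  The action of a product, for matrices that multiply only up to a scalar. The denominator at
  \<open>u\<close> of the product is the product of the denominators along the way, so that if the two end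
  points are finite then so is the step between them.
\<close>

lemma mob_mult:
  assumes C: "C = mat c ** (A ** B)"
    and den: "mob_den B u \<noteq> 0" "mob_den C u \<noteq> 0"
  shows "mob_den A (mob B u) \<noteq> 0" and "mob C u = mob A (mob B u)"
proof -
  have d: "mob_den C u = c * mob_den B u * mob_den A (mob B u)"
    using den(1) unfolding C mob_def mob_num_def mob_den_def mat_mult_nth
    by (simp add: matrix_matrix_mult_def sum_2 field_simps)
  then show "mob_den A (mob B u) \<noteq> 0" using den(2) by auto
  have n: "mob_num C u = c * mob_den B u * mob_num A (mob B u)"
    using den(1) unfolding C mob_def mob_num_def mob_den_def mat_mult_nth
    by (simp add: matrix_matrix_mult_def sum_2 field_simps)
  show "mob C u = mob A (mob B u)"
    using d den(2) unfolding mob_def [of C] n d by (simp add: mob_def [of A])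
qed

lemma finite_mob_den_eq_0:
  assumes "det A \<noteq> 0"
  shows "finite {u. mob_den A u = 0}"
proof -
  have "[:A$2$2, A$2$1:] \<noteq> 0" using assms by (auto simp: det_2)
  then have "finite {u. poly [:A$2$2, A$2$1:] u = 0}" by (rule poly_roots_finite)
  then show ?thesis by (simp add: mob_den_def algebra_simps)
qed

lemma finite_mob_fixed_points:
  assumes "\<And>c. A \<noteq> mat c"
  shows "finite {u. mob_num A u = u * mob_den A u}"
proof -
  have "[:A$1$2, A$1$1 - A$2$2, - A$2$1:] \<noteq> 0"
  proof
    assume "[:A$1$2, A$1$1 - A$2$2, - A$2$1:] = 0"
    then have "A = mat (A$1$1)" by (simp add: vec_eq_iff forall_2 mat_def)
    then show False using assms by blast
  qed
  then have "finite {u. poly [:A$1$2, A$1$1 - A$2$2, - A$2$1:] u = 0}" by (rule poly_roots_finite)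
  then show ?thesis by (rule rev_finite_subset) (auto simp: mob_num_def mob_den_def algebra_simps)
qed

text \<open>
  The matrices represent the group in \<open>PGL\<^sub>2(\<complex>)\<close>: they multiply up to scalars, and faithfulness
  means that only the identity element is represented by a scalar matrix.
\<close>

locale moebius_group = group \<Gamma> for \<Gamma> (structure) +
  fixes A :: "'a \<Rightarrow> complex^2^2"
  assumes finite_carrier: "finite (carrier \<Gamma>)"
    and det_rep: "g \<in> carrier \<Gamma> \<Longrightarrow> det (A g) \<noteq> 0"
    and rep_mult: "g \<in> carrier \<Gamma> \<Longrightarrow> h \<in> carrier \<Gamma> \<Longrightarrow> \<exists>c. A (g \<otimes> h) = mat c ** (A g ** A h)"
    and rep_faithful: "g \<in> carrier \<Gamma> \<Longrightarrow> A g = mat c \<Longrightarrow> g = \<one>"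
begin

lemma rep_one: "\<exists>c. mat c ** A \<one> = mat 1"
proof -
  obtain c where c: "A \<one> = mat c ** (A \<one> ** A \<one>)" using rep_mult [of \<one> \<one>] by auto
  have "invertible (A \<one>)" using det_rep [of \<one>] by (simp add: invertible_det_nz)
  then obtain B where B: "A \<one> ** B = mat 1" by (auto simp: invertible_def)
  have "mat 1 = (mat c ** (A \<one> ** A \<one>)) ** B" using B c by simp
  also have "\<dots> = mat c ** (A \<one> ** (A \<one> ** B))" by (simp add: matrix_mul_assoc)
  finally show ?thesis using B by (auto intro!: exI [of _ c])
qed

text \<open>
  A vanishing denominator means that \<open>g\<close> carries \<open>u\<close> to infinity, where \<open>mob\<close> would return the
  default value 0 of a division by zero; such points are therefore excluded.
\<close>

definition free_point :: "complex \<Rightarrow> bool" where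
  "free_point u \<longleftrightarrow> (\<forall>g\<in>carrier \<Gamma>. mob_den (A g) u \<noteq> 0) \<and>
     (\<forall>g\<in>carrier \<Gamma>. g \<noteq> \<one> \<longrightarrow> mob (A g) u \<noteq> u)"

text \<open>
  Each nonscalar transformation has at most two fixed points and each transformation at most one
  finite pole, so that a finite group excludes only finitely many points.
\<close>

lemma ex_free_point: "\<exists>u. free_point u"
proof -
  have "finite ((\<Union>g\<in>carrier \<Gamma>. {u. mob_den (A g) u = 0}) \<union>
      (\<Union>g\<in>carrier \<Gamma> - {\<one>}. {u. mob_num (A g) u = u * mob_den (A g) u}))"
    using rep_faithful
    by (intro finite_UnI finite_UN_I finite_Diff finite_carrier finite_mob_den_eq_0
        finite_mob_fixed_points det_rep) auto
  then obtain u where "u \<notin> (\<Union>g\<in>carrier \<Gamma>. {u. mob_den (A g) u = 0}) \<union>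
      (\<Union>g\<in>carrier \<Gamma> - {\<one>}. {u. mob_num (A g) u = u * mob_den (A g) u})"
    using ex_new_if_finite [OF infinite_UNIV_char_0] by blast
  then have "free_point u" by (auto simp: free_point_def mob_def field_simps)
  then show ?thesis ..
qed

context
  fixes u assumes u: "free_point u"
begin

lemma orbit_mult:
  assumes "g \<in> carrier \<Gamma>" "h \<in> carrier \<Gamma>"
  shows "mob_den (A g) (mob (A h) u) \<noteq> 0" and "mob (A (g \<otimes> h)) u = mob (A g) (mob (A h) u)"
proof -
  obtain c where "A (g \<otimes> h) = mat c ** (A g ** A h)" using rep_mult assms by blast
  moreover have "mob_den (A h) u \<noteq> 0" "mob_den (A (g \<otimes> h)) u \<noteq> 0"
    using u assms by (auto simp: free_point_def)
  ultimately show "mob_den (A g) (mob (A h) u) \<noteq> 0" "mob (A (g \<otimes> h)) u = mob (A g) (mob (A h) u)"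
    by (rule mob_mult)+
qed

lemma mob_rep_one: "mob (A \<one>) u = u"
proof -
  obtain c where c: "mat c ** A \<one> = mat 1" using rep_one by blast
  have "c * mob_num (A \<one>) u = u" "c * mob_den (A \<one>) u = 1"
    using arg_cong [OF c, of "\<lambda>M. M$1$1 * u + M$1$2"] arg_cong [OF c, of "\<lambda>M. M$2$1 * u + M$2$2"]
    unfolding mat_mult_nth by (simp_all add: mob_num_def mob_den_def mat_def algebra_simps)
  then have "mob_num (A \<one>) u = u * mob_den (A \<one>) u" "mob_den (A \<one>) u \<noteq> 0"
    by (metis mult.assoc mult.commute mult.right_neutral, auto)
  then show ?thesis by (simp add: mob_def)
qed

lemma inj_orbit: "inj_on (\<lambda>g. mob (A g) u) (carrier \<Gamma>)"
proof (rule inj_onI)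
  fix g h assume gh: "g \<in> carrier \<Gamma>" "h \<in> carrier \<Gamma>" "mob (A g) u = mob (A h) u"
  then have "mob (A (inv h \<otimes> g)) u = mob (A (inv h)) (mob (A h) u)" by (simp add: orbit_mult(2))
  also have "\<dots> = mob (A (inv h \<otimes> h)) u" using gh by (simp only: orbit_mult(2) inv_closed)
  finally have "mob (A (inv h \<otimes> g)) u = u" using gh mob_rep_one by simp
  then have "inv h \<otimes> g = \<one>" using u gh by (auto simp: free_point_def)
  then show "g = h" using gh by (metis inv_equality inv_inv inv_closed)
qed

context
  fixes S assumes S: "S \<subseteq> carrier \<Gamma>"
begin

lemma finite_S: "finite S"
  using S finite_carrier by (rule finite_subset)

lemma det_S: "s \<in> S \<Longrightarrow> det (A s) \<noteq> 0"
  using S det_rep by blast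

text \<open>
  The matrix \<open>co_mat (A s)\<close> acts on the orbit as \<open>s\<inverse>\<close>, like \<open>A (inv s)\<close>, of which it is a
  multiple.
\<close>

lemma co_mat_orbit:
  assumes "s \<in> S" "g \<in> carrier \<Gamma>"
  shows "mob_den (co_mat (A s)) (mob (A g) u) \<noteq> 0"
    and "mob (co_mat (A s)) (mob (A g) u) = mob (A (inv s \<otimes> g)) u"
proof -
  have s: "s \<in> carrier \<Gamma>" using assms S by auto
  have "mob (A g) u = mob (A (s \<otimes> (inv s \<otimes> g))) u" using s assms by (simp add: m_assoc [symmetric])
  also have "\<dots> = mob (A s) (mob (A (inv s \<otimes> g)) u)" using s assms by (intro orbit_mult) auto
  finally show "mob_den (co_mat (A s)) (mob (A g) u) \<noteq> 0"
      "mob (co_mat (A s)) (mob (A g) u) = mob (A (inv s \<otimes> g)) u"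
    using mob_co_mat [OF det_rep [OF s] orbit_mult(1) [of s "inv s \<otimes> g"]] s assms by auto
qed

lemma separating_orbit:
  assumes g: "g \<in> carrier \<Gamma>"
  shows "separating A S (mob (A g) u)" and "separating (\<lambda>s. co_mat (A s)) S (mob (A g) u)"
proof -
  have "inj_on (\<lambda>s. mob (A (s \<otimes> g)) u) S"
    using S g by (intro inj_onI) (auto dest!: inj_onD [OF inj_orbit] simp: subset_iff)
  then show "separating A S (mob (A g) u)"
    using S g by (auto simp: separating_def orbit_mult subset_iff inj_on_def)
  have "inj_on (\<lambda>s. mob (A (inv s \<otimes> g)) u) S"
  proof (rule inj_onI)
    fix s t assume st: "s \<in> S" "t \<in> S" "mob (A (inv s \<otimes> g)) u = mob (A (inv t \<otimes> g)) u"
    then have c: "s \<in> carrier \<Gamma>" "t \<in> carrier \<Gamma>" using S by auto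
    then have "inv s \<otimes> g = inv t \<otimes> g" using inj_onD [OF inj_orbit st(3)] g by simp
    then show "s = t" using c g inv_inv by (metis inv_closed right_cancel)
  qed
  then show "separating (\<lambda>s. co_mat (A s)) S (mob (A g) u)"
    using g by (auto simp: separating_def co_mat_orbit inj_on_def)
qed

lemma arc_mult_orbit:
  assumes "g \<in> carrier \<Gamma>" "h \<in> carrier \<Gamma>"
  shows "arc_mult (graphs_poly A S) (mob (A g) u) (mob (A h) u) = (if \<exists>s\<in>S. h = s \<otimes> g then 1 else 0)"
proof -
  have "mob (A h) u = mob (A s) (mob (A g) u) \<longleftrightarrow> h = s \<otimes> g" if "s \<in> S" for s
    using that S assms inj_onD [OF inj_orbit, of h "s \<otimes> g"] orbit_mult(2) [of s g] by auto
  then show ?thesis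
    by (simp add: arc_mult_separating [OF finite_S det_S separating_orbit(1)] assms(1) cong: bex_cong)
qed

text \<open>
  An arc from \<open>w\<close> to \<open>g u\<close> means that \<open>(w, g u)\<close> lies on one of the curves. There \<open>w\<close> cannot
  be a pole of \<open>s\<close>, since numerator and denominator would vanish together, so that
  \<open>w = s\<inverse> g u\<close>.
\<close>

lemma orbit_closed:
  assumes g: "g \<in> carrier \<Gamma>"
    and "arc_mult (graphs_poly A S) (mob (A g) u) w > 0 \<or> arc_mult (graphs_poly A S) w (mob (A g) u) > 0"
  shows "w \<in> (\<lambda>g. mob (A g) u) ` carrier \<Gamma>"
  using assms(2)
proof
  assume "arc_mult (graphs_poly A S) (mob (A g) u) w > 0"
  then obtain s where s: "s \<in> S" "w = mob (A s) (mob (A g) u)"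
    by (auto simp: arc_mult_separating [OF finite_S det_S separating_orbit(1) [OF g]] split: if_splits)
  then have "s \<otimes> g \<in> carrier \<Gamma>" "w = mob (A (s \<otimes> g)) u" using S g orbit_mult(2) [of s g] by auto
  then show ?thesis by blast
next
  assume "arc_mult (graphs_poly A S) w (mob (A g) u) > 0"
  then obtain s where s: "s \<in> S" "mob_num (A s) w = mob (A g) u * mob_den (A s) w"
    using arc_mult_posD [of S A w] finite_S det_S by blast
  then have den: "mob_den (A s) w \<noteq> 0" using mob_num_den_not_both_0 [OF det_S] by force
  then have "mob (A s) w = mob (A g) u" using s by (simp add: mob_def)
  then have "w = mob (A (inv s \<otimes> g)) u"
    using mob_co_mat(2) [OF det_S den] s co_mat_orbit(2) [OF s(1) g] by simp
  moreover have "inv s \<otimes> g \<in> carrier \<Gamma>" using s S g by auto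
  ultimately show ?thesis by blast
qed

end

end

text \<open>
  The polynomial is the product of the graphs of the elements of \<open>S\<close>, and the vertex set is the
  orbit of a free point. Every point of a free orbit satisfies the conditions that exclude
  singular vertices.
\<close>

theorem cayley_digraph_polynomial:
  assumes S: "S \<subseteq> carrier \<Gamma>" "S \<noteq> {}" "\<one> \<notin> S"
  shows "g \<in> carrier \<Gamma> \<Longrightarrow> polynomial_digraph (component (cayley_digraph \<Gamma> S) g)"
    and "\<exists>\<Phi> V. standard_poly \<Phi> \<and> union_of_nonsingular_components \<Phi> V \<and>
       digraph_iso (cayley_digraph \<Gamma> S) (poly_digraph \<Phi> \<restriction> V)"
proof -
  obtain u where u: "free_point u" using ex_free_point by blast
  let ?\<Phi> = "graphs_poly A S" and ?\<phi> = "\<lambda>g. mob (A g) u" and ?C = "cayley_digraph \<Gamma> S"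
  note fin = finite_S [OF u S(1)]
  note arcs = arc_mult_orbit [OF u S(1)] and closed = orbit_closed [OF u S(1)]
  have nofix: "mob (A s) (?\<phi> h) \<noteq> ?\<phi> h" if "s \<in> S" "h \<in> carrier \<Gamma>" for s h
  proof
    assume "mob (A s) (?\<phi> h) = ?\<phi> h"
    then have "s \<otimes> h = h"
      using that S orbit_mult(2) [OF u, of s h] inj_onD [OF inj_orbit [OF u], of "s \<otimes> h" h] by auto
    then show False using that S by auto
  qed
  have std: "standard_poly ?\<Phi>"
    using standard_graphs_poly [OF fin _ separating_orbit [OF u S(1) one_closed]
        nofix [OF _ one_closed] S(2)] det_S [OF u S(1)] by simp
  have ns: "\<not> singular_vertex ?\<Phi> (?\<phi> h)" if "h \<in> carrier \<Gamma>" for h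
    using not_singular_graphs_poly [OF fin _ separating_orbit [OF u S(1) that] nofix [OF _ that]]
      det_S [OF u S(1)] by simp
  have comp: "component_verts (poly_digraph ?\<Phi>) (?\<phi> h) = ?\<phi> ` component_verts ?C h"
    if "h \<in> carrier \<Gamma>" for h
    using that by (intro component_verts_image [OF S(1) inj_orbit [OF u] arcs closed]) auto
  have sub: "component_verts ?C h \<subseteq> carrier \<Gamma>" if "h \<in> carrier \<Gamma>" for h
    by (rule component_verts_cayley_subset [OF S(1) that])
  have nsc: "nonsingular_component_of ?\<Phi> (?\<phi> h)" if "h \<in> carrier \<Gamma>" for h
    using comp [OF that] sub [OF that] ns by (auto simp: nonsingular_component_of_def)
  have iso: "digraph_iso (?C \<restriction> W) (poly_digraph ?\<Phi> \<restriction> ?\<phi> ` W)" if "W \<subseteq> carrier \<Gamma>" for W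
    by (rule cayley_iso_poly_digraph [OF S(1) that inj_orbit [OF u] arcs])
  show "polynomial_digraph (component ?C g)" if g: "g \<in> carrier \<Gamma>"
    unfolding polynomial_digraph_def
  proof (intro conjI exI [of _ "card S"] exI [of _ ?\<Phi>] disjI2 exI [of _ "?\<phi> g"])
    show "digraph_iso (component ?C g) (component (poly_digraph ?\<Phi>) (?\<phi> g))"
      using iso [OF sub [OF g]] comp [OF g] by (simp add: component_def)
  qed (use g std nsc regular_component_cayley [OF S(1) fin] in auto)
  have "union_of_nonsingular_components ?\<Phi> (?\<phi> ` carrier \<Gamma>)"
    using nsc by (simp add: union_of_nonsingular_components_def comp image_mono sub)
  then show "\<exists>\<Phi> V. standard_poly \<Phi> \<and> union_of_nonsingular_components \<Phi> V \<and>
       digraph_iso ?C (poly_digraph \<Phi> \<restriction> V)"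
    using iso [OF subset_refl] std unfolding cayley_digraph_induce_carrier [OF S(1)] by blast
qed

end

text \<open>
  Faithfulness is asked in the form that elements with scalar matrices are idempotent: this can be
  checked without knowing that \<open>\<Delta>\<close> is a group, and the identity is the only idempotent
  of \<open>\<Gamma>\<close>.
\<close>

lemma moebius_group_iso:
  fixes \<Gamma> :: "('g, 'm) monoid_scheme" and \<Delta> :: "('h, 'n) monoid_scheme"
  assumes "group \<Gamma>" and h: "h \<in> iso \<Gamma> \<Delta>" and fin: "finite (carrier \<Delta>)"
    and det: "\<And>x. x \<in> carrier \<Delta> \<Longrightarrow> det (A x) \<noteq> 0"
    and mult: "\<And>x y. x \<in> carrier \<Delta> \<Longrightarrow> y \<in> carrier \<Delta> \<Longrightarrow>
      \<exists>c. A (x \<otimes>\<^bsub>\<Delta>\<^esub> y) = mat c ** (A x ** A y)"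
    and faithful: "\<And>x c. x \<in> carrier \<Delta> \<Longrightarrow> A x = mat c \<Longrightarrow> x \<otimes>\<^bsub>\<Delta>\<^esub> x = x"
  shows "moebius_group \<Gamma> (\<lambda>g. A (h g))"
proof -
  interpret group \<Gamma> by fact
  have bij: "bij_betw h (carrier \<Gamma>) (carrier \<Delta>)" and hom: "h \<in> hom \<Gamma> \<Delta>"
    using h by (auto simp: iso_def)
  have mem: "h g \<in> carrier \<Delta>" if "g \<in> carrier \<Gamma>" for g using hom that by (rule hom_in_carrier)
  show ?thesis
  proof unfold_locales
    show "finite (carrier \<Gamma>)" using bij fin bij_betw_finite by blast
    show "g = \<one>\<^bsub>\<Gamma>\<^esub>" if g: "g \<in> carrier \<Gamma>" and c: "A (h g) = mat c" for g c
    proof -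
      have "h (g \<otimes>\<^bsub>\<Gamma>\<^esub> g) = h g" using faithful [OF mem [OF g] c] hom g by (simp add: hom_mult)
      then have "g \<otimes>\<^bsub>\<Gamma>\<^esub> g = g" using bij g by (auto simp: bij_betw_def dest: inj_onD)
      then show ?thesis using g by (simp add: r_cancel_one)
    qed
  qed (use det mult mem hom in \<open>auto simp: hom_mult\<close>)
qed

section \<open>Dihedral groups\<close>

lemma mat_mult_mat: "mat c ** mat d = (mat (c * d) :: complex^2^2)"
  by (simp add: vec_eq_iff mat_mult_nth) (simp add: mat_def)

definition diag2 :: "complex \<Rightarrow> complex \<Rightarrow> complex^2^2" where
  "diag2 a b = vector [vector [a, 0], vector [0, b]]"

definition flip_mat :: "complex^2^2" where
  "flip_mat = vector [vector [0, 1], vector [1, 0]]"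

lemma diag2_mult: "diag2 a b ** diag2 c d = diag2 (a * c) (b * d)"
  by (simp add: diag2_def vec_eq_iff forall_2 matrix_matrix_mult_def sum_2)

lemma flip_diag2: "flip_mat ** diag2 a b = diag2 b a ** flip_mat"
  by (simp add: diag2_def flip_mat_def vec_eq_iff forall_2 matrix_matrix_mult_def sum_2)

lemma flip_flip: "flip_mat ** flip_mat = mat 1"
  by (simp add: flip_mat_def vec_eq_iff forall_2 matrix_matrix_mult_def sum_2 mat_def)

lemma diag2_eq_mat: "diag2 a b = mat c \<longleftrightarrow> a = c \<and> b = c"
  by (auto simp: diag2_def vec_eq_iff forall_2 mat_def)

lemma diag2_flip_neq_mat: "a \<noteq> 0 \<Longrightarrow> diag2 a b ** flip_mat \<noteq> mat c"
  by (simp add: diag2_def flip_mat_def vec_eq_iff forall_2 matrix_matrix_mult_def sum_2 mat_def)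

text \<open>
  The transformations are \<open>f : z \<mapsto> \<omega>\<^sup>2 z\<close> and \<open>t : z \<mapsto> 1 / z\<close>. Normalising the matrix of
  \<open>f\<close> to determinant 1 lets the relator \<open>t f t f\<close> hold exactly.
\<close>

primrec letter_mat :: "complex \<Rightarrow> dihedral_gen \<Rightarrow> bool \<Rightarrow> complex^2^2" where
  "letter_mat \<omega> gen_f b = (if b then diag2 \<omega> (inverse \<omega>) else diag2 (inverse \<omega>) \<omega>)"
| "letter_mat \<omega> gen_t b = flip_mat"

primrec word_mat :: "complex \<Rightarrow> (dihedral_gen \<times> bool) list \<Rightarrow> complex^2^2" where
  "word_mat \<omega> [] = mat 1"
| "word_mat \<omega> (l # w) = letter_mat \<omega> (fst l) (snd l) ** word_mat \<omega> w"

lemma word_mat_append: "word_mat \<omega> (u @ v) = word_mat \<omega> u ** word_mat \<omega> v"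
  by (induction u) (simp_all add: matrix_mul_assoc)

lemma word_mat_replicate_f:
  "word_mat \<omega> (replicate k (gen_f, True)) = diag2 (\<omega> ^ k) (inverse \<omega> ^ k)"
  by (induction k) (simp_all add: diag2_mult diag2_eq_mat [THEN iffD2])

lemma det_word_mat: "\<omega> \<noteq> 0 \<Longrightarrow> det (word_mat \<omega> w) \<noteq> 0"
proof (induction w)
  case (Cons l w)
  have "det (letter_mat \<omega> (fst l) (snd l)) \<noteq> 0"
    using Cons.prems by (cases "fst l") (simp_all add: diag2_def flip_mat_def det_2)
  then show ?case using Cons by (simp add: det_mul)
qed simp

text \<open>
  All relations hold exactly except \<open>f\<^sup>n = 1\<close>, for which the product is the scalar
  \<open>\<omega>\<^sup>n = \<plusminus>1\<close>. This sign is why the matrices represent the group only up to scalars.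
\<close>

lemma word_mat_dihedral_eq:
  assumes "\<omega> ^ (2 * n) = 1" and "n \<ge> 1" and "word_eq (dihedral_relators n) u v"
  shows "\<exists>c. c \<noteq> 0 \<and> word_mat \<omega> u = mat c ** word_mat \<omega> v"
  using assms(3)
proof (induction rule: word_eq.induct)
  case (refl u)
  then show ?case by (intro exI [of _ 1]) simp
next
  case (sym u v)
  then obtain c where "c \<noteq> 0" "word_mat \<omega> u = mat c ** word_mat \<omega> v" by blast
  then show ?case
    by (intro exI [of _ "inverse c"]) (simp add: matrix_mul_assoc mat_mult_mat)
next
  case (trans u v w)
  then obtain c d where "c \<noteq> 0" "d \<noteq> 0" "word_mat \<omega> u = mat c ** word_mat \<omega> v"
    "word_mat \<omega> v = mat d ** word_mat \<omega> w" by blast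
  then show ?case
    by (intro exI [of _ "c * d"]) (simp add: matrix_mul_assoc mat_mult_mat)
next
  case (cancel u g b v)
  have "\<omega> \<noteq> 0" using assms(1,2) by (auto simp: power_0_left)
  then have "letter_mat \<omega> g b ** letter_mat \<omega> g (\<not> b) = mat 1"
    by (cases g) (simp_all add: diag2_mult diag2_eq_mat flip_flip)
  then have "word_mat \<omega> [(g, b), (g, \<not> b)] = mat 1" by simp
  then show ?case by (intro exI [of _ 1]) (simp only: word_mat_append matrix_mul_lid, simp)
next
  case (relator r u v)
  have nz: "\<omega> \<noteq> 0" using assms(1,2) by (auto simp: power_0_left)
  have "\<exists>c. c \<noteq> 0 \<and> word_mat \<omega> r = mat c"
  proof -
    consider "r = replicate n (gen_f, True)" | "r = [(gen_t, True), (gen_t, True)]"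
      | "r = [(gen_t, True), (gen_f, True), (gen_t, True), (gen_f, True)]"
      using relator by (auto simp: dihedral_relators_def Let_def)
    then show ?thesis
    proof cases
      case 1
      have "\<omega> ^ n * \<omega> ^ n = 1" using assms(1) by (simp add: mult_2 power_add)
      then have "inverse \<omega> ^ n = \<omega> ^ n" by (metis inverse_unique power_inverse)
      then show ?thesis
        using 1 nz by (intro exI [of _ "\<omega> ^ n"]) (simp add: word_mat_replicate_f diag2_eq_mat)
    next
      case 2
      then show ?thesis by (intro exI [of _ 1]) (simp add: flip_flip)
    next
      case 3
      have "word_mat \<omega> r = (flip_mat ** diag2 \<omega> (inverse \<omega>)) ** (flip_mat ** diag2 \<omega> (inverse \<omega>))"
        using 3 by (simp add: matrix_mul_assoc)
      also have "\<dots> = (diag2 (inverse \<omega>) \<omega> ** flip_mat) ** (flip_mat ** diag2 \<omega> (inverse \<omega>))"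
        by (simp only: flip_diag2)
      also have "\<dots> = diag2 (inverse \<omega>) \<omega> ** (flip_mat ** flip_mat) ** diag2 \<omega> (inverse \<omega>)"
        by (simp only: matrix_mul_assoc)
      also have "\<dots> = mat 1" using nz by (simp add: flip_flip diag2_mult diag2_eq_mat)
      finally show ?thesis by (intro exI [of _ 1]) simp
    qed
  qed
  then obtain c where "c \<noteq> 0" "word_mat \<omega> r = mat c" by blast
  then show ?case
    by (intro exI [of _ c]) (simp add: word_mat_append matrix_mul_assoc mat_mult_right)
qed

lemma word_eq_replicate_reduce:
  assumes "word_eq R (replicate n x) []" and "n \<ge> 1"
  shows "\<exists>j<n. word_eq R (replicate i x) (replicate j x)"
proof (induction i rule: less_induct)
  case (less i)
  show ?case
  proof (cases "i < n")
    case True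
    then show ?thesis by (blast intro: word_eq.refl)
  next
    case False
    then have "replicate i x = replicate n x @ replicate (i - n) x"
      by (metis le_add_diff_inverse not_less replicate_add)
    then have "word_eq R (replicate i x) (replicate (i - n) x)"
      using word_eq_append_right [OF assms(1)] by simp
    moreover have "i - n < i" using False assms(2) by simp
    ultimately show ?thesis using less.IH word_eq.trans by blast
  qed
qed

text \<open>
  The relators give \<open>t f = f\<^sup>n\<^sup>-\<^sup>1 t\<close>, so that every \<open>t\<close> moves to the right past all \<open>f\<close>;
  inverse letters are replaced by positive words, and \<open>f\<^sup>n\<close> and \<open>t\<^sup>2\<close> are then removed.
\<close>

lemma dihedral_normal_form:
  assumes n: "n \<ge> 1"
  shows "\<exists>i<n. \<exists>j<2. word_eq (dihedral_relators n) w
    (replicate i (gen_f, True) @ replicate j (gen_t, True))"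
proof -
  let ?R = "dihedral_relators n" and ?f = "(gen_f, True)" and ?t = "(gen_t, True)"
  note [trans] = word_eq.trans
  note app = word_eq_append_left word_eq_append_right
  have rel: "word_eq ?R (u @ r @ v) (u @ v)" if "r \<in> ?R" for u r v
    using that by (rule word_eq.relator)
  have fn: "word_eq ?R (replicate n ?f) []" and tt: "word_eq ?R [?t, ?t] []"
    and tftf: "word_eq ?R [?t, ?f, ?t, ?f] []"
    using rel [of _ "[]" "[]"] by (simp_all add: dihedral_relators_def Let_def)
  have n': "replicate n x = x # replicate (n - 1) x" "replicate n x = replicate (n - 1) x @ [x]"
    for x :: "dihedral_gen \<times> bool"
    using n by (cases n; simp add: replicate_append_same)+
  have f_inv: "word_eq ?R [(gen_f, False)] (replicate (n - 1) ?f)"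
  proof -
    have "word_eq ?R [(gen_f, False)] ([(gen_f, False)] @ replicate n ?f)"
      using app(1) [OF fn, of "[(gen_f, False)]"] by (simp add: word_eq.sym)
    also have "word_eq ?R \<dots> (replicate (n - 1) ?f)"
      using word_eq.cancel [of ?R "[]" gen_f False "replicate (n - 1) ?f"] by (simp add: n'(1))
    finally show ?thesis .
  qed
  have t_inv: "word_eq ?R [(gen_t, False)] [?t]"
  proof -
    have "word_eq ?R [(gen_t, False)] ([(gen_t, False)] @ [?t, ?t])"
      using app(1) [OF tt, of "[(gen_t, False)]"] by (simp add: word_eq.sym)
    also have "word_eq ?R \<dots> [?t]"
      using word_eq.cancel [of ?R "[]" gen_t False "[?t]"] by simp
    finally show ?thesis .
  qed
  have tf: "word_eq ?R [?t, ?f] (replicate (n - 1) ?f @ [?t])"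
  proof -
    have "word_eq ?R [?t, ?f] (replicate n ?f @ [?t, ?f])"
      using app(2) [OF fn, of "[?t, ?f]"] by (simp add: word_eq.sym)
    also have "word_eq ?R (replicate n ?f @ [?t, ?f]) ((replicate (n - 1) ?f @ [?t, ?t]) @ [?f, ?t, ?f])"
      using word_eq.sym [OF app(2) [OF app(1) [OF tt, of "replicate (n - 1) ?f"], of "[?f, ?t, ?f]"]]
      by (simp add: n'(2))
    also have "word_eq ?R \<dots> (replicate (n - 1) ?f @ [?t])"
      using app(1) [OF tftf, of "replicate (n - 1) ?f @ [?t]"] by simp
    finally show ?thesis .
  qed
  have tfi: "word_eq ?R (?t # replicate i ?f) (replicate ((n - 1) * i) ?f @ [?t])" for i
  proof (induction i)
    case 0
    then show ?case by (simp add: word_eq.refl)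
  next
    case (Suc i)
    have "word_eq ?R (?t # replicate (Suc i) ?f) ((replicate (n - 1) ?f @ [?t]) @ replicate i ?f)"
      using app(2) [OF tf, of "replicate i ?f"] by simp
    also have "word_eq ?R \<dots> (replicate (n - 1) ?f @ replicate ((n - 1) * i) ?f @ [?t])"
      using app(1) [OF Suc, of "replicate (n - 1) ?f"] by simp
    finally show ?case by (simp add: replicate_add)
  qed
  have "\<exists>i j. word_eq ?R w (replicate i ?f @ replicate j ?t)"
  proof (induction w)
    case Nil
    show ?case by (intro exI [of _ 0]) (simp add: word_eq.refl)
  next
    case (Cons l w)
    then obtain i j where ij: "word_eq ?R w (replicate i ?f @ replicate j ?t)" by blast
    have lw: "word_eq ?R (l # w) (l # replicate i ?f @ replicate j ?t)"
      using app(1) [OF ij, of "[l]"] by simp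
    have t: "word_eq ?R (?t # replicate i ?f @ replicate j ?t)
        (replicate ((n - 1) * i) ?f @ replicate (Suc j) ?t)"
      using app(2) [OF tfi, of i "replicate j ?t"] by simp
    consider "l = ?f" | "l = (gen_f, False)" | "l = ?t" | "l = (gen_t, False)"
      by (metis (full_types) dihedral_gen.exhaust surj_pair)
    then show ?case
    proof cases
      case 1
      then have "word_eq ?R (l # w) (replicate (Suc i) ?f @ replicate j ?t)" using lw by simp
      then show ?thesis by blast
    next
      case 2
      note lw
      also have "word_eq ?R (l # replicate i ?f @ replicate j ?t)
          (replicate (n - 1 + i) ?f @ replicate j ?t)"
        using app(2) [OF f_inv, of "replicate i ?f @ replicate j ?t"] 2 by (simp add: replicate_add)
      finally show ?thesis by blast
    next
      case 3
      then show ?thesis using word_eq.trans [OF lw] t by blast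
    next
      case 4
      note lw
      also have "word_eq ?R (l # replicate i ?f @ replicate j ?t) (?t # replicate i ?f @ replicate j ?t)"
        using app(2) [OF t_inv, of "replicate i ?f @ replicate j ?t"] 4 by simp
      also note t
      finally show ?thesis by blast
    qed
  qed
  then obtain i j where w: "word_eq ?R w (replicate i ?f @ replicate j ?t)" by blast
  obtain i' where i': "i' < n" "word_eq ?R (replicate i ?f) (replicate i' ?f)"
    using word_eq_replicate_reduce [OF fn n] by blast
  have "word_eq ?R (replicate 2 ?t) []" using tt by (simp add: numeral_2_eq_2)
  then obtain j' where j': "j' < 2" "word_eq ?R (replicate j ?t) (replicate j' ?t)"
    using word_eq_replicate_reduce [of ?R 2 ?t j] by auto
  have "word_eq ?R w (replicate i' ?f @ replicate j' ?t)"
    using w word_eq_append [OF i'(2) j'(2)] by (rule word_eq.trans)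
  then show ?thesis using i'(1) j'(1) by blast
qed

lemma finite_dihedral_group:
  assumes "n \<ge> 1"
  shows "finite (carrier (dihedral_group n))"
proof -
  have "carrier (dihedral_group n) \<subseteq> (\<lambda>(i, j). word_class (dihedral_relators n)
      (replicate i (gen_f, True) @ replicate j (gen_t, True))) ` ({..<n} \<times> {..<2})"
  proof
    fix X assume "X \<in> carrier (dihedral_group n)"
    then obtain w where w: "X = word_class (dihedral_relators n) w"
      by (auto simp: dihedral_group_def presented_group_def)
    obtain i j where ij: "i < n" "j < 2" "X = word_class (dihedral_relators n)
        (replicate i (gen_f, True) @ replicate j (gen_t, True))"
      using dihedral_normal_form [OF assms, of w] unfolding w word_class_eq_iff by blast
    then show "X \<in> (\<lambda>(i, j). word_class (dihedral_relators n)
      (replicate i (gen_f, True) @ replicate j (gen_t, True))) ` ({..<n} \<times> {..<2})"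
      by (intro image_eqI [of _ _ "(i, j)"]) auto
  qed
  then show ?thesis by (rule finite_subset) simp
qed

text \<open>
  For a word in normal form \<open>f\<^sup>i t\<^sup>j\<close>, a scalar matrix forces \<open>j = 0\<close> and
  \<open>\<omega>\<^sup>i = \<omega>\<^sup>-\<^sup>i\<close>, whence \<open>i = 0\<close> because \<open>2i < 2n\<close> and \<open>\<omega>\<close> has order \<open>2n\<close>.
\<close>

lemma word_mat_scalar_imp_trivial:
  assumes n: "n \<ge> 1" and \<omega>: "\<And>k. \<omega> ^ k = 1 \<longleftrightarrow> 2 * n dvd k" and c: "word_mat \<omega> w = mat c"
  shows "word_eq (dihedral_relators n) w []"
proof -
  let ?f = "(gen_f, True)" and ?t = "(gen_t, True)"
  have one: "\<omega> ^ (2 * n) = 1" using \<omega> by simp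
  then have nz: "\<omega> \<noteq> 0" using n by (auto simp: power_0_left)
  obtain i j where ij: "i < n" "j < 2"
    and w: "word_eq (dihedral_relators n) w (replicate i ?f @ replicate j ?t)"
    using dihedral_normal_form [OF n] by blast
  obtain d where "word_mat \<omega> (replicate i ?f @ replicate j ?t) = mat d ** word_mat \<omega> w"
    using word_mat_dihedral_eq [OF one n word_eq.sym [OF w]] by blast
  then have d: "diag2 (\<omega> ^ i) (inverse \<omega> ^ i) ** word_mat \<omega> (replicate j ?t) = mat (d * c)"
    by (simp add: c word_mat_append word_mat_replicate_f mat_mult_mat)
  have j: "j = 0"
  proof (rule ccontr)
    assume "j \<noteq> 0"
    then have "j = 1" using ij by simp
    then show False using d diag2_flip_neq_mat nz by simp
  qed
  then have "\<omega> ^ i = inverse \<omega> ^ i" using d by (simp add: diag2_eq_mat)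
  then have "\<omega> ^ i * \<omega> ^ i = 1" using nz by (metis power_inverse power_not_zero right_inverse)
  then have "\<omega> ^ (2 * i) = 1" by (simp add: mult_2 power_add)
  then have "i = 0" using \<omega> ij by (auto dest: dvd_imp_le)
  then show ?thesis using w j by simp
qed

lemma ex_primitive_root_of_unity:
  assumes "N \<ge> 1"
  shows "\<exists>\<omega>::complex. \<forall>k. \<omega> ^ k = 1 \<longleftrightarrow> N dvd k"
proof (intro exI allI)
  fix k
  have "exp (2 * of_real pi * \<i> / of_nat N) ^ k = exp (2 * of_real pi * \<i> * of_nat k / of_nat N)"
    by (simp add: exp_of_nat_mult [symmetric] mult_ac)
  then show "exp (2 * of_real pi * \<i> / of_nat N) ^ k = 1 \<longleftrightarrow> N dvd k"
    using complex_root_unity_eq_1 [OF assms] by simp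
qed

theorem moebius_group_dihedral:
  assumes "group \<Gamma>" and n: "n \<ge> 1" and iso: "\<Gamma> \<cong> dihedral_group n"
  shows "\<exists>A. moebius_group \<Gamma> A" and "carrier \<Gamma> \<noteq> {\<one>\<^bsub>\<Gamma>\<^esub>}"
proof -
  let ?R = "dihedral_relators n" and ?D = "dihedral_group n"
  obtain \<omega> :: complex where \<omega>: "\<And>k. \<omega> ^ k = 1 \<longleftrightarrow> 2 * n dvd k"
    using ex_primitive_root_of_unity [of "2 * n"] n by auto
  have one: "\<omega> ^ (2 * n) = 1" using \<omega> by simp
  then have nz: "\<omega> \<noteq> 0" using n by (auto simp: power_0_left)
  obtain h where h: "h \<in> iso \<Gamma> ?D" using iso by (auto simp: is_iso_def)
  define rep where "rep X = (SOME w. X = word_class ?R w)" for X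
  have rep: "X = word_class ?R (rep X)" if "X \<in> carrier ?D" for X
    using that unfolding rep_def
    by (intro someI_ex [of "\<lambda>w. X = word_class ?R w"]) (auto simp: dihedral_group_def presented_group_def)
  have mult: "word_class ?R u \<otimes>\<^bsub>?D\<^esub> word_class ?R v = word_class ?R (u @ v)" for u v
    by (simp add: dihedral_group_def presented_group_mult)
  have "moebius_group \<Gamma> (\<lambda>g. word_mat \<omega> (rep (h g)))"
  proof (rule moebius_group_iso [OF assms(1) h finite_dihedral_group [OF n]])
    fix X assume X: "X \<in> carrier ?D"
    show "det (word_mat \<omega> (rep X)) \<noteq> 0" using nz by (rule det_word_mat)
    {
      fix Y assume Y: "Y \<in> carrier ?D"
      have "X \<otimes>\<^bsub>?D\<^esub> Y = word_class ?R (rep X @ rep Y)" using rep [OF X] rep [OF Y] mult by metis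
      moreover from this have "X \<otimes>\<^bsub>?D\<^esub> Y = word_class ?R (rep (X \<otimes>\<^bsub>?D\<^esub> Y))"
        by (intro rep) (simp add: dihedral_group_def presented_group_def)
      ultimately have "word_eq ?R (rep (X \<otimes>\<^bsub>?D\<^esub> Y)) (rep X @ rep Y)"
        using word_class_eq_iff by metis
      then show "\<exists>c. word_mat \<omega> (rep (X \<otimes>\<^bsub>?D\<^esub> Y)) = mat c ** (word_mat \<omega> (rep X) ** word_mat \<omega> (rep Y))"
        using word_mat_dihedral_eq [OF one n] by (metis word_mat_append)
    next
      fix c assume "word_mat \<omega> (rep X) = mat c"
      then have "word_class ?R (rep X) = word_class ?R []"
        using word_mat_scalar_imp_trivial [OF n \<omega>] by (simp add: word_class_eq_iff)
      then have "X = word_class ?R []" using rep [OF X] by simp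
      then show "X \<otimes>\<^bsub>?D\<^esub> X = X" by (simp add: mult)
    }
  qed
  then show "\<exists>A. moebius_group \<Gamma> A" by blast
  show "carrier \<Gamma> \<noteq> {\<one>\<^bsub>\<Gamma>\<^esub>}"
  proof
    assume triv: "carrier \<Gamma> = {\<one>\<^bsub>\<Gamma>\<^esub>}"
    have "carrier ?D = h ` carrier \<Gamma>" using h by (auto simp: iso_def bij_betw_def)
    then have "word_class ?R w \<in> {h \<one>\<^bsub>\<Gamma>\<^esub>}" for w
      using triv rangeI [of "word_class ?R" w] by (simp add: dihedral_group_def presented_group_def)
    then have "word_class ?R [(gen_t, True)] = word_class ?R []" by (metis singletonD)
    then obtain c where "word_mat \<omega> [(gen_t, True)] = mat c ** word_mat \<omega> []"
      unfolding word_class_eq_iff using word_mat_dihedral_eq [OF one n] by blast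
    then have "flip_mat = mat c" by simp
    then show False by (simp add: flip_mat_def vec_eq_iff forall_2 mat_def)
  qed
qed

section \<open>The spin representation of the rotations of space\<close>

definition pauli :: "real^3 \<Rightarrow> complex^2^2" where
  "pauli v = vector [vector [of_real (v$3), of_real (v$1) - \<i> * of_real (v$2)],
                     vector [of_real (v$1) + \<i> * of_real (v$2), - of_real (v$3)]]"

text \<open>
  The multiplication table of the Pauli matrices. It involves only the inner product and the cross
  product, both of which rotations preserve, so that the matrices \<open>pauli (Q *v v)\<close> satisfy the
  same relations as the matrices \<open>pauli v\<close>.
\<close>

lemma pauli_mult_vec:
  "pauli u *v (pauli v *v x) = of_real (u \<bullet> v) *s x + \<i> *s (pauli (cross3 u v) *v x)"
  by (simp add: vec_eq_iff forall_2 pauli_def matrix_vector_mult_def sum_2 inner_vec_def sum_3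
      cross3_def algebra_simps)

lemma pauli_linear:
  "pauli (u + v) = pauli u + pauli v" "pauli (c *\<^sub>R v) = mat (of_real c) ** pauli v"
  by (simp_all add: pauli_def vec_eq_iff forall_2 mat_mult_nth algebra_simps)

lemma pauli_inj: "pauli u = pauli v \<Longrightarrow> u = v"
proof -
  assume "pauli u = pauli v"
  then have 1: "of_real (u$3) = (of_real (v$3) :: complex)"
    and 2: "of_real (u$1) - \<i> * of_real (u$2) = of_real (v$1) - \<i> * of_real (v$2)"
    by (simp_all add: pauli_def vec_eq_iff forall_2)
  have "u$1 = v$1" using arg_cong [OF 2, of Re] by simp
  moreover have "u$2 = v$2" using arg_cong [OF 2, of Im] by simp
  ultimately show "u = v" using 1 by (simp add: vec_eq_iff forall_3)
qed

text \<open>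
  Conjugation by an invertible \<open>A\<close> of this kind induces the rotation \<open>Q\<close> on the span of the Pauli
  matrices, so that \<open>A\<close> is one of the two lifts of \<open>Q\<close> to the spin group, up to a scalar.
\<close>

definition intertwines :: "complex^2^2 \<Rightarrow> real^3^3 \<Rightarrow> bool" where
  "intertwines A Q \<longleftrightarrow> (\<forall>v. A ** pauli v = pauli (Q *v v) ** A)"

lemma intertwinesD: "intertwines A Q \<Longrightarrow> A ** pauli v = pauli (Q *v v) ** A"
  by (simp add: intertwines_def)

lemma intertwines_mult:
  assumes "intertwines A Q" and "intertwines B R"
  shows "intertwines (A ** B) (Q ** R)"
  unfolding intertwines_def
proof
  fix v
  have "A ** B ** pauli v = A ** (pauli (R *v v) ** B)"
    using intertwinesD [OF assms(2)] by (simp flip: matrix_mul_assoc)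
  also have "\<dots> = pauli (Q *v (R *v v)) ** A ** B"
    using intertwinesD [OF assms(1)] by (simp add: matrix_mul_assoc)
  finally show "A ** B ** pauli v = pauli (Q ** R *v v) ** (A ** B)"
    by (simp add: matrix_mul_assoc matrix_vector_mul_assoc)
qed

lemma commutes_with_pauli_imp_scalar:
  assumes "\<And>v. B ** pauli v = pauli v ** B"
  shows "\<exists>c. B = mat c"
proof -
  have eq: "(B ** pauli v) $ i $ j = (pauli v ** B) $ i $ j" for v i j using assms by simp
  have "B$1$2 = 0" using eq [of "axis 3 1" 1 2]
    by (simp add: pauli_def matrix_matrix_mult_def sum_2 axis_def)
  moreover have "B$2$1 = 0" using eq [of "axis 3 1" 2 1]
    by (simp add: pauli_def matrix_matrix_mult_def sum_2 axis_def)
  moreover have "B$2$2 = B$1$1" using eq [of "axis 1 1" 1 2]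
    by (simp add: pauli_def matrix_matrix_mult_def sum_2 axis_def)
  ultimately have "B = mat (B$1$1)" by (simp add: vec_eq_iff forall_2 mat_def)
  then show ?thesis ..
qed

text \<open>
  The kernel of an intertwiner is stable under all Pauli matrices, and these carry any
  nonzero vector to a set of vectors that spans the plane.
\<close>

lemma det_intertwiner:
  assumes A: "intertwines A Q" and nz: "A \<noteq> 0"
  shows "det A \<noteq> 0"
proof
  assume "det A = 0"
  then have "\<not> (\<exists>B. B ** A = mat 1)" by (metis invertible_left_inverse invertible_det_nz)
  then obtain x where x: "A *v x = 0" "x \<noteq> 0" unfolding matrix_left_invertible_ker by blast
  have "A *v (pauli v *v x) = 0" for v
    using arg_cong [OF intertwinesD [OF A], of "\<lambda>M. M *v x" v] x(1)
    by (simp flip: matrix_vector_mul_assoc)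
  then have eq: "(A *v (pauli v *v x)) $ i = 0" for v i by simp
  have 0: "A$i$1 * x$1 + A$i$2 * x$2 = 0" for i
    using arg_cong [OF x(1), of "\<lambda>y. y $ i"] by (simp add: matrix_vector_mult_def sum_2)
  have 1: "A$i$1 * x$2 + A$i$2 * x$1 = 0" for i using eq [of "axis 1 1" i]
    by (simp add: pauli_def matrix_vector_mult_def sum_2 axis_def)
  have 2: "\<i> * (A$i$2 * x$1 - A$i$1 * x$2) = 0" for i using eq [of "axis 2 1" i]
    by (simp add: pauli_def matrix_vector_mult_def sum_2 axis_def algebra_simps)
  have 3: "A$i$1 * x$1 - A$i$2 * x$2 = 0" for i using eq [of "axis 3 1" i]
    by (simp add: pauli_def matrix_vector_mult_def sum_2 axis_def)
  have "A$i$1 * x$1 = 0" "A$i$2 * x$2 = 0" "A$i$1 * x$2 = 0" "A$i$2 * x$1 = 0" for i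
    using 0 [of i] 1 [of i] 2 [of i] 3 [of i] by auto
  moreover have "x$1 \<noteq> 0 \<or> x$2 \<noteq> 0" using x(2) by (auto simp: vec_eq_iff forall_2)
  ultimately have "A = 0" by (auto simp: vec_eq_iff forall_2)
  then show False using nz by simp
qed

text \<open>
  Schur's lemma: \<open>A\<inverse> B\<close> commutes with the Pauli matrices, hence is scalar.
\<close>

lemma intertwiner_unique:
  assumes A: "intertwines A Q" "A \<noteq> 0" and B: "intertwines B Q"
  shows "\<exists>c. B = mat c ** A"
proof -
  obtain A' where A': "A ** A' = mat 1" "A' ** A = mat 1"
    using det_intertwiner [OF A] invertible_det_nz [of A] by (auto simp: invertible_def)
  have "A' ** B ** pauli v = pauli v ** (A' ** B)" for v
  proof -
    have "A' ** B ** pauli v = A' ** pauli (Q *v v) ** (A ** A') ** B"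
      using intertwinesD [OF B, of v] A' by (simp flip: matrix_mul_assoc)
    also have "\<dots> = A' ** (pauli (Q *v v) ** A) ** A' ** B" by (simp add: matrix_mul_assoc)
    also have "\<dots> = A' ** (A ** pauli v) ** A' ** B" using intertwinesD [OF A(1), of v] by simp
    also have "\<dots> = (A' ** A) ** pauli v ** (A' ** B)" by (simp add: matrix_mul_assoc)
    finally show ?thesis using A' by simp
  qed
  then obtain c where c: "A' ** B = mat c" using commutes_with_pauli_imp_scalar by blast
  have "B = A ** (A' ** B)" using A' by (simp add: matrix_mul_assoc)
  then show ?thesis using c mat_mult_right by metis
qed

text \<open>
  Let \<open>T\<^sub>k\<close> denote the Pauli matrix of \<open>Q e\<^sub>k\<close>. An intertwiner sends the first basis vector to an
  eigenvector of \<open>T\<^sub>3\<close> with eigenvalue 1 and the second one to the image of that eigenvector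
  under \<open>T\<^sub>1\<close>. The vector \<open>x + T\<^sub>3 x\<close> is such an eigenvector unless it vanishes, and it
  cannot vanish for both basis vectors \<open>x\<close> because \<open>T\<^sub>3\<close> has trace 0.
\<close>

lemma intertwiner_exists:
  assumes "rotation_matrix Q"
  shows "\<exists>A. A \<noteq> 0 \<and> intertwines A Q"
proof -
  define q where "q k = Q *v axis k 1" for k
  have orth: "q k \<bullet> q l = (if k = l then 1 else 0)" for k l
  proof -
    have "orthogonal_transformation ((*v) Q)"
      using assms by (simp add: rotation_matrix_def orthogonal_transformation_matrix)
    then have "q k \<bullet> q l = axis k 1 \<bullet> (axis l 1 :: real^3)"
      by (simp add: q_def orthogonal_transformation_def)
    then show ?thesis by (simp add: inner_axis_axis)
  qed
  have "cross3 (q k) (q l) = Q *v cross3 (axis k 1) (axis l 1)" for k l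
    unfolding q_def using assms by (rule cross_rotation_matrix)
  then have cross: "cross3 (q 1) (q 2) = q 3" "cross3 (q 2) (q 3) = q 1" "cross3 (q 3) (q 1) = q 2"
    by (simp_all add: cross_basis q_def)
  then have cross': "cross3 (q 2) (q 1) = - q 3" "cross3 (q 3) (q 2) = - q 1" "cross3 (q 1) (q 3) = - q 2"
    by (metis cross_skew)+
  have pauli_0: "pauli 0 *v x = 0" for x
    by (simp add: pauli_def vec_eq_iff forall_2 matrix_vector_mult_def sum_2)
  have pauli_minus: "pauli (- v) = - pauli v" for v
    by (simp add: pauli_def vec_eq_iff forall_2)
  have minus_mult: "(- M) *v x = - (M *v x)" for M :: "complex^2^2" and x
    by (simp add: vec_eq_iff matrix_vector_mult_def sum_negf)
  define T where "T k x = pauli (q k) *v x" for k x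
  have T_add: "T k (x + y) = T k x + T k y" and T_scale: "T k (c *s x) = c *s T k x" for k x y c
    by (simp_all add: T_def matrix_vector_right_distrib vector_scalar_commute)
  have TT: "T k (T k x) = x" "T 1 (T 2 x) = \<i> *s T 3 x" "T 2 (T 3 x) = \<i> *s T 1 x" "T 3 (T 1 x) = \<i> *s T 2 x"
      "T 2 (T 1 x) = - \<i> *s T 3 x" "T 3 (T 2 x) = - \<i> *s T 1 x" "T 1 (T 3 x) = - \<i> *s T 2 x" for k x
    unfolding T_def pauli_mult_vec by (simp_all add: orth cross cross' pauli_0 pauli_minus minus_mult vec_eq_iff)
  have main: "\<exists>A. A \<noteq> 0 \<and> intertwines A Q" if x: "x + T 3 x \<noteq> 0" for x
  proof -
    \<comment> \<open>The columns of the intertwiner: \<open>c2\<close> is \<open>T 1 c1\<close>, rewritten with \<open>T 1 (T 3 x) = - \<i> *s T 2 x\<close>.\<close>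
    define c1 c2 where "c1 = x + T 3 x" and "c2 = T 1 x + (- \<i>) *s T 2 x"
    have t1: "T 1 c1 = c2" "T 1 c2 = c1" and t2: "T 2 c1 = \<i> *s c2" "T 2 c2 = (- \<i>) *s c1"
      and t3: "T 3 c1 = c1" "T 3 c2 = - c2"
      unfolding c1_def c2_def T_add T_scale TT by (simp_all add: vec_eq_iff algebra_simps)
    define A :: "complex^2^2" where "A = (\<chi> i j. if j = 1 then c1$i else c2$i)"
    have A: "(M ** A)$i$1 = (M *v c1)$i" "(M ** A)$i$2 = (M *v c2)$i" for M :: "complex^2^2" and i
      by (simp_all add: A_def matrix_matrix_mult_def matrix_vector_mult_def)
    have A': "(A ** M)$i$j = c1$i * M$1$j + c2$i * M$2$j" for M :: "complex^2^2" and i j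
      by (simp add: A_def matrix_matrix_mult_def sum_2)
    have basis: "A ** pauli (axis k 1) = pauli (q k) ** A" for k
    proof -
      consider "k = 1" | "k = 2" | "k = 3" using exhaust_3 [of k] by blast
      then show ?thesis
        by cases (simp_all add: vec_eq_iff forall_2 A A' t1 t2 t3 flip: T_def,
            simp_all add: pauli_def axis_def)
    qed
    have "A ** pauli v = pauli (Q *v v) ** A" for v
    proof -
      have v: "v = v$1 *\<^sub>R axis 1 1 + v$2 *\<^sub>R axis 2 1 + v$3 *\<^sub>R axis 3 1"
        by (simp add: vec_eq_iff forall_3 axis_def)
      have Qv: "Q *v v = v$1 *\<^sub>R q 1 + v$2 *\<^sub>R q 2 + v$3 *\<^sub>R q 3"
        by (subst v) (simp only: matrix_vector_right_distrib matrix_vector_mult_scaleR q_def)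
      have "A ** pauli v = mat (of_real (v$1)) ** (A ** pauli (axis 1 1)) +
          mat (of_real (v$2)) ** (A ** pauli (axis 2 1)) + mat (of_real (v$3)) ** (A ** pauli (axis 3 1))"
        by (subst v) (simp only: pauli_linear matrix_add_ldistrib matrix_mul_assoc mat_mult_right)
      also have "\<dots> = pauli (Q *v v) ** A"
      proof -
        have rdistrib: "(M + N) ** A = M ** A + N ** A" for M N
          by (simp add: vec_eq_iff matrix_matrix_mult_def sum.distrib distrib_right)
        then show ?thesis unfolding basis Qv by (simp only: pauli_linear rdistrib matrix_mul_assoc)
      qed
      finally show ?thesis .
    qed
    moreover have "A \<noteq> 0"
      using x by (auto simp: A_def vec_eq_iff forall_2 c1_def)
    ultimately show ?thesis by (auto simp: intertwines_def)
  qed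
  let ?z = "complex_of_real (q 3 $ 3)"
  have "(axis 1 1 + T 3 (axis 1 1)) $ 1 = 1 + ?z" "(axis 2 1 + T 3 (axis 2 1)) $ 2 = 1 - ?z"
    by (simp_all add: T_def pauli_def matrix_vector_mult_def sum_2 axis_def)
  moreover have "1 + ?z \<noteq> 0 \<or> 1 - ?z \<noteq> 0" by (auto simp: add_eq_0_iff)
  ultimately have "axis 1 1 + T 3 (axis 1 1) \<noteq> 0 \<or> axis 2 1 + T 3 (axis 2 1) \<noteq> 0"
    by (metis zero_index)
  then show ?thesis using main by blast
qed

text \<open>
  The Pauli matrix of a vector determines the vector.
\<close>

lemma scalar_intertwiner:
  assumes "intertwines (mat c) Q" and "c \<noteq> 0"
  shows "Q = mat 1"
proof -
  have "Q *v v = v" for v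
  proof -
    have "mat c ** pauli v = mat c ** pauli (Q *v v)"
      using intertwinesD [OF assms(1), of v] by (simp add: mat_mult_right)
    then have "pauli v = pauli (Q *v v)" using assms(2) by (simp add: vec_eq_iff mat_mult_nth)
    then show ?thesis using pauli_inj by metis
  qed
  then show ?thesis by (simp add: matrix_eq)
qed

text \<open>
  Any choice will do, as intertwiners are unique up to a scalar.
\<close>

definition spin :: "real^3^3 \<Rightarrow> complex^2^2" where
  "spin Q = (SOME A. A \<noteq> 0 \<and> intertwines A Q)"

lemma spin:
  assumes "rotation_matrix Q"
  shows "spin Q \<noteq> 0" and "intertwines (spin Q) Q"
  using someI_ex [OF intertwiner_exists [OF assms]] by (simp_all add: spin_def)

lemma det_spin: "rotation_matrix Q \<Longrightarrow> det (spin Q) \<noteq> 0"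
  using spin det_intertwiner by blast

lemma rotation_matrix_mult:
  fixes Q R :: "real^'n^'n"
  shows "rotation_matrix Q \<Longrightarrow> rotation_matrix R \<Longrightarrow> rotation_matrix (Q ** R)"
  by (auto simp: rotation_matrix_def det_mul intro: orthogonal_matrix_mul)

lemma spin_mult:
  assumes "rotation_matrix Q" "rotation_matrix R"
  shows "\<exists>c. spin (Q ** R) = mat c ** (spin Q ** spin R)"
proof (rule intertwiner_unique)
  show "intertwines (spin Q ** spin R) (Q ** R)" by (intro intertwines_mult spin assms)
  show "intertwines (spin (Q ** R)) (Q ** R)" by (intro spin rotation_matrix_mult assms)
  have "det (spin Q ** spin R) \<noteq> 0" using det_spin assms by (simp add: det_mul)
  then show "spin Q ** spin R \<noteq> 0" by (auto simp: det_2)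
qed

lemma spin_faithful:
  assumes "rotation_matrix Q" and "spin Q = mat c"
  shows "Q = mat 1"
proof (rule scalar_intertwiner)
  show "intertwines (mat c) Q" using spin(2) [OF assms(1)] assms(2) by simp
  show "c \<noteq> 0" using spin(1) [OF assms(1)] assms(2) by (auto simp: vec_eq_iff mat_def)
qed

section \<open>Rotation groups of regular polyhedra\<close>

definition lin_part :: "(real^3 \<Rightarrow> real^3) \<Rightarrow> real^3^3" where
  "lin_part \<sigma> = matrix (\<lambda>x. \<sigma> x - \<sigma> 0)"

lemma lin_part_affine: "lin_part (\<lambda>x. Q *v x + b) = Q"
  by (simp add: lin_part_def)

lemma lin_part_isometry:
  assumes "\<And>x y. dist (\<sigma> x) (\<sigma> y) = dist x y"
  shows "orthogonal_matrix (lin_part \<sigma>)" and "\<sigma> x = lin_part \<sigma> *v x + \<sigma> 0"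
proof -
  have "orthogonal_transformation (\<lambda>x. \<sigma> x - \<sigma> 0)"
    using assms by (simp add: orthogonal_transformation_isometry dist_norm)
  then have *: "linear (\<lambda>x. \<sigma> x - \<sigma> 0)" "orthogonal_matrix (lin_part \<sigma>)"
    by (auto simp: orthogonal_transformation_matrix lin_part_def)
  then show "orthogonal_matrix (lin_part \<sigma>)" by simp
  have "lin_part \<sigma> *v x = \<sigma> x - \<sigma> 0"
    unfolding lin_part_def using *(1) by (simp add: matrix_works)
  then show "\<sigma> x = lin_part \<sigma> *v x + \<sigma> 0" by simp
qed

lemma lin_part_comp:
  assumes "\<And>x. \<sigma> x = Q *v x + b" and "\<And>x. \<tau> x = R *v x + c"
  shows "lin_part (\<sigma> \<circ> \<tau>) = Q ** R"
proof -
  have "\<sigma> \<circ> \<tau> = (\<lambda>x. (Q ** R) *v x + (Q *v c + b))"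
    by (simp add: fun_eq_iff assms matrix_vector_right_distrib matrix_vector_mul_assoc)
  then show ?thesis by (simp only: lin_part_affine)
qed

lemma mem_rotation_group:
  "\<sigma> \<in> carrier (rotation_group P) \<longleftrightarrow> symmetry P \<sigma> \<and> rotation_matrix (lin_part \<sigma>)"
proof
  assume "\<sigma> \<in> carrier (rotation_group P)"
  then obtain Q b where \<sigma>: "symmetry P \<sigma>" "rotation_matrix Q" "\<And>x. \<sigma> x = Q *v x + b"
    by (auto simp: rotation_group_def)
  then have "\<sigma> = (\<lambda>x. Q *v x + b)" by blast
  then have "lin_part \<sigma> = Q" by (simp only: lin_part_affine)
  then show "symmetry P \<sigma> \<and> rotation_matrix (lin_part \<sigma>)" using \<sigma> by simp
next
  assume *: "symmetry P \<sigma> \<and> rotation_matrix (lin_part \<sigma>)"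
  then have "\<And>x. \<sigma> x = lin_part \<sigma> *v x + \<sigma> 0"
    by (intro lin_part_isometry(2)) (simp add: symmetry_def)
  then have "\<exists>Q b. rotation_matrix Q \<and> (\<forall>x. \<sigma> x = Q *v x + b)" using * by blast
  then show "\<sigma> \<in> carrier (rotation_group P)" using * by (simp add: rotation_group_def)
qed

lemma symmetry_lin_part:
  assumes "symmetry P \<sigma>"
  shows "orthogonal_matrix (lin_part \<sigma>)" and "\<sigma> x = lin_part \<sigma> *v x + \<sigma> 0"
proof -
  have iso: "\<And>x y. dist (\<sigma> x) (\<sigma> y) = dist x y" using assms by (simp add: symmetry_def)
  show "orthogonal_matrix (lin_part \<sigma>)" by (rule lin_part_isometry(1) [OF iso])
  show "\<sigma> x = lin_part \<sigma> *v x + \<sigma> 0" by (rule lin_part_isometry(2) [OF iso])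
qed

lemma symmetry_comp: "symmetry P \<sigma> \<Longrightarrow> symmetry P \<tau> \<Longrightarrow> symmetry P (\<sigma> \<circ> \<tau>)"
  unfolding symmetry_def image_comp [symmetric] by simp

text \<open>
  Iterating the translation would carry a point of \<open>P\<close> out of every bounded set.
\<close>

lemma translation_symmetry_trivial:
  fixes b :: "'a::real_normed_vector"
  assumes "bounded P" and "P \<noteq> {}" and "(\<lambda>x. x + b) ` P \<subseteq> P"
  shows "b = 0"
proof (rule ccontr)
  assume "b \<noteq> 0"
  obtain p where p: "p \<in> P" using assms(2) by blast
  have orbit: "p + real n *\<^sub>R b \<in> P" for n
  proof (induction n)
    case (Suc n)
    then have "p + real n *\<^sub>R b + b \<in> P" using assms(3) by blast
    then show ?case by (simp add: algebra_simps)
  qed (simp add: p)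
  obtain B where B: "\<And>x. x \<in> P \<Longrightarrow> norm x \<le> B" using assms(1) by (auto simp: bounded_iff)
  obtain n where n: "(B + norm p) / norm b < real n" using reals_Archimedean2 by blast
  have "real n * norm b = norm ((p + real n *\<^sub>R b) - p)" by simp
  also have "\<dots> \<le> norm (p + real n *\<^sub>R b) + norm p" by (rule norm_triangle_ineq4)
  also have "\<dots> \<le> B + norm p" using B [OF orbit] by simp
  finally show False using n \<open>b \<noteq> 0\<close> by (simp add: field_simps)
qed

text \<open>
  A symmetry is affine and permutes the finitely many vertices, whose affine hull is the whole
  space.
\<close>

lemma finite_symmetries:
  fixes P :: "(real^3) set"
  assumes P: "polytope P" "aff_dim P = 3"
  shows "finite {\<sigma>. symmetry P \<sigma>}"
proof -
  define K where "K = {x. x extreme_point_of P}"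
  have finK: "finite K" unfolding K_def
    by (intro finite_polyhedron_extreme_points polytope_imp_polyhedron P)
  have P_hull: "P = convex hull K" unfolding K_def
    by (intro Krein_Milman_Minkowski polytope_imp_compact polytope_imp_convex P)
  have aff: "affine hull K = UNIV"
  proof -
    have "aff_dim K = 3" using P(2) P_hull by (metis aff_dim_convex_hull)
    then show ?thesis using aff_dim_eq_full [of K] by simp
  qed
  have map: "\<sigma> x \<in> K" if \<sigma>: "symmetry P \<sigma>" and x: "x \<in> K" for \<sigma> x
  proof -
    let ?L = "(*v) (lin_part \<sigma>)"
    have inj: "inj ?L"
      using symmetry_lin_part(1) [OF \<sigma>] orthogonal_transformation_inj
      by (metis matrix_of_matrix_vector_mul matrix_vector_mul_linear orthogonal_transformation_matrix)
    have \<sigma>': "\<sigma> = (\<lambda>y. \<sigma> 0 + y) \<circ> ?L"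
      by (rule ext) (subst symmetry_lin_part(2) [OF \<sigma>], simp)
    have "{x} face_of P" using x by (simp add: K_def face_of_singleton)
    then have "(\<lambda>y. \<sigma> 0 + y) ` ?L ` {x} face_of (\<lambda>y. \<sigma> 0 + y) ` ?L ` P"
      by (simp only: face_of_translation_eq face_of_linear_image [OF matrix_vector_mul_linear inj])
    moreover have "(\<lambda>y. \<sigma> 0 + y) ` ?L ` {x} = {\<sigma> x}"
      using symmetry_lin_part(2) [OF \<sigma>, of x] by (simp add: add.commute)
    moreover have "(\<lambda>y. \<sigma> 0 + y) ` ?L ` P = P"
      using \<sigma> \<sigma>' unfolding symmetry_def by (metis image_comp)
    ultimately show ?thesis by (simp add: K_def face_of_singleton)
  qed
  have "inj_on (\<lambda>\<sigma>. restrict \<sigma> K) {\<sigma>. symmetry P \<sigma>}"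
  proof (rule inj_onI, clarify)
    fix \<sigma> \<tau> assume st: "symmetry P \<sigma>" "symmetry P \<tau>" "restrict \<sigma> K = restrict \<tau> K"
    have "K \<subseteq> {x. \<sigma> x = \<tau> x}" using st(3) by (metis (mono_tags, lifting) mem_Collect_eq restrict_apply' subsetI)
    moreover have "affine {x. \<sigma> x = \<tau> x}"
    proof -
      have "{x. \<sigma> x = \<tau> x} = {x. lin_part \<sigma> *v x + \<sigma> 0 = lin_part \<tau> *v x + \<tau> 0}"
        using symmetry_lin_part(2) [OF st(1)] symmetry_lin_part(2) [OF st(2)] by metis
      moreover have "affine {x. lin_part \<sigma> *v x + \<sigma> 0 = lin_part \<tau> *v x + \<tau> 0}"
        unfolding affine_def
      proof (intro ballI allI impI CollectI)
        fix x y :: "real^3" and u v :: real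
        assume "x \<in> {x. lin_part \<sigma> *v x + \<sigma> 0 = lin_part \<tau> *v x + \<tau> 0}"
          "y \<in> {x. lin_part \<sigma> *v x + \<sigma> 0 = lin_part \<tau> *v x + \<tau> 0}" and uv: "u + v = 1"
        then have x: "lin_part \<sigma> *v x + \<sigma> 0 = lin_part \<tau> *v x + \<tau> 0"
          and y: "lin_part \<sigma> *v y + \<sigma> 0 = lin_part \<tau> *v y + \<tau> 0" by auto
        have comb: "M *v (u *\<^sub>R x + v *\<^sub>R y) + b = u *\<^sub>R (M *v x + b) + v *\<^sub>R (M *v y + b)"
          for M :: "real^3^3" and b
          using uv by (simp add: matrix_vector_right_distrib matrix_vector_mult_scaleR scaleR_right_distrib
              flip: scaleR_left_distrib)
        show "lin_part \<sigma> *v (u *\<^sub>R x + v *\<^sub>R y) + \<sigma> 0 = lin_part \<tau> *v (u *\<^sub>R x + v *\<^sub>R y) + \<tau> 0"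
          unfolding comb x y ..
      qed
      ultimately show ?thesis by simp
    qed
    ultimately have "affine hull K \<subseteq> {x. \<sigma> x = \<tau> x}" by (rule hull_minimal)
    then show "\<sigma> = \<tau>" using aff by auto
  qed
  moreover have "(\<lambda>\<sigma>. restrict \<sigma> K) ` {\<sigma>. symmetry P \<sigma>} \<subseteq> K \<rightarrow>\<^sub>E K" using map by auto
  moreover have "finite (K \<rightarrow>\<^sub>E K)" using finK by (simp add: finite_PiE)
  ultimately show ?thesis by (metis finite_imageD finite_subset)
qed

text \<open>
  A proper nonempty face of a polytope lies in a facet: this is applied to the vertex first in the
  polyhedron and then in the facet so found.
\<close>

lemma vertex_in_flag:
  assumes P: "polytope P" "aff_dim P = 3" and v: "v extreme_point_of P"
  shows "\<exists>E F. flag P ({v}, E, F)"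
proof -
  have vP: "{v} face_of P" using v by (simp add: face_of_singleton)
  moreover have "{v} \<noteq> P" using P(2) by auto
  ultimately obtain F where F: "F facet_of P" "{v} \<subseteq> F"
    using face_of_polyhedron_subset_facet [OF polytope_imp_polyhedron [OF P(1)]] by blast
  then have F': "F face_of P" "aff_dim F = 2" using P(2) by (auto simp: facet_of_def)
  have "polytope F" using face_of_polytope_polytope [OF P(1) F'(1)] .
  moreover have "{v} face_of F" using face_of_face [OF F'(1)] vP F(2) by blast
  moreover have "{v} \<noteq> F" using F'(2) by auto
  ultimately obtain E where E: "E facet_of F" "{v} \<subseteq> E"
    using face_of_polyhedron_subset_facet [OF polytope_imp_polyhedron] by blast
  then have "E face_of F" "aff_dim E = 1" using F'(2) by (auto simp: facet_of_def)
  moreover from this have "E face_of P" "E \<subseteq> F" using F'(1) face_of_trans face_of_imp_subset by blast+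
  ultimately have "flag P ({v}, E, F)" using vP F' E(2) by (simp add: flag_def)
  then show ?thesis by blast
qed

text \<open>
  There are three distinct vertices \<open>x\<close>, \<open>y\<close>, \<open>z\<close>, and symmetries that carry \<open>x\<close> to \<open>y\<close> and
  \<open>y\<close> to \<open>z\<close>. If neither of the two is a rotation then both reverse the orientation, and their
  composition is a rotation that carries \<open>x\<close> to \<open>z\<close>.
\<close>

lemma regular_polyhedron_nontrivial_rotation:
  assumes "regular_polyhedron P"
  shows "\<exists>\<sigma> \<in> carrier (rotation_group P). \<sigma> \<noteq> id"
proof -
  have P: "polytope P" "aff_dim P = 3" using assms by (auto simp: regular_polyhedron_def)
  define K where "K = {x. x extreme_point_of P}"
  have finK: "finite K" unfolding K_def
    by (intro finite_polyhedron_extreme_points polytope_imp_polyhedron P)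
  have "P = convex hull K" unfolding K_def
    by (intro Krein_Milman_Minkowski polytope_imp_compact polytope_imp_convex P)
  then have "aff_dim K = 3" using P(2) by (metis aff_dim_convex_hull)
  then have "3 \<le> card K" using aff_dim_le_card [OF finK] by simp
  then obtain T where "T \<subseteq> K" "card T = 3" by (meson obtain_subset_with_card_n)
  then obtain x y z where xyz: "x \<in> K" "y \<in> K" "z \<in> K" "x \<noteq> y" "y \<noteq> z" "x \<noteq> z"
    by (auto simp: card_3_iff)
  have trans: "\<exists>\<sigma>. symmetry P \<sigma> \<and> \<sigma> v = w" if vw: "v \<in> K" "w \<in> K" for v w
  proof -
    obtain E F E' F' where "flag P ({v}, E, F)" "flag P ({w}, E', F')"
      using vertex_in_flag [OF P] vw unfolding K_def by blast
    then obtain \<sigma> where "symmetry P \<sigma>" "\<sigma> ` {v} = {w}"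
      using assms unfolding regular_polyhedron_def by blast
    then show ?thesis by auto
  qed
  obtain \<sigma> \<tau> where \<sigma>: "symmetry P \<sigma>" "\<sigma> x = y" and \<tau>: "symmetry P \<tau>" "\<tau> y = z"
    using trans xyz by metis
  have lin: "lin_part (\<tau> \<circ> \<sigma>) = lin_part \<tau> ** lin_part \<sigma>"
    using symmetry_lin_part(2) [OF \<tau>(1)] symmetry_lin_part(2) [OF \<sigma>(1)] by (rule lin_part_comp)
  have orth: "orthogonal_matrix (lin_part \<sigma>)" "orthogonal_matrix (lin_part \<tau>)"
    using symmetry_lin_part(1) \<sigma>(1) \<tau>(1) by auto
  consider "det (lin_part \<sigma>) = 1" | "det (lin_part \<tau>) = 1"
    | "det (lin_part \<sigma>) = - 1" "det (lin_part \<tau>) = - 1"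
    using det_orthogonal_matrix orth by blast
  then show ?thesis
  proof cases
    case 1
    then have "\<sigma> \<in> carrier (rotation_group P)"
      using orth \<sigma>(1) by (simp add: mem_rotation_group rotation_matrix_def)
    moreover have "\<sigma> \<noteq> id" using \<sigma>(2) xyz by auto
    ultimately show ?thesis by blast
  next
    case 2
    then have "\<tau> \<in> carrier (rotation_group P)"
      using orth \<tau>(1) by (simp add: mem_rotation_group rotation_matrix_def)
    moreover have "\<tau> \<noteq> id" using \<tau>(2) xyz by auto
    ultimately show ?thesis by blast
  next
    case 3
    then have "det (lin_part (\<tau> \<circ> \<sigma>)) = 1" by (simp add: lin det_mul)
    then have "\<tau> \<circ> \<sigma> \<in> carrier (rotation_group P)"
      using lin orth symmetry_comp [OF \<tau>(1) \<sigma>(1)]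
      by (simp add: mem_rotation_group rotation_matrix_def orthogonal_matrix_mul)
    moreover have "(\<tau> \<circ> \<sigma>) x \<noteq> id x" using \<sigma>(2) \<tau>(2) xyz by simp
    ultimately show ?thesis by metis
  qed
qed

theorem moebius_group_rotation_group:
  fixes \<Gamma> :: "('g, 'm) monoid_scheme"
  assumes "group \<Gamma>" and P: "regular_polyhedron P" and iso: "\<Gamma> \<cong> rotation_group P"
  shows "\<exists>A. moebius_group \<Gamma> A" and "carrier \<Gamma> \<noteq> {\<one>\<^bsub>\<Gamma>\<^esub>}"
proof -
  let ?R = "rotation_group P"
  have P': "polytope P" "aff_dim P = 3" using P by (auto simp: regular_polyhedron_def)
  have "bounded P" "P \<noteq> {}" using P' polytope_imp_bounded by auto
  note no_translation = translation_symmetry_trivial [OF this]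
  obtain h where h: "h \<in> iso \<Gamma> ?R" using iso by (auto simp: is_iso_def)
  have mult: "\<sigma> \<otimes>\<^bsub>?R\<^esub> \<tau> = \<sigma> \<circ> \<tau>" for \<sigma> \<tau> by (simp add: rotation_group_def)
  have "moebius_group \<Gamma> (\<lambda>g. spin (lin_part (h g)))"
  proof (rule moebius_group_iso [OF assms(1) h])
    show "finite (carrier ?R)"
      by (rule finite_subset [OF _ finite_symmetries [OF P']]) (auto simp: mem_rotation_group)
    fix \<sigma> assume \<sigma>: "\<sigma> \<in> carrier ?R"
    then have \<sigma>': "symmetry P \<sigma>" "rotation_matrix (lin_part \<sigma>)" by (auto simp: mem_rotation_group)
    show "det (spin (lin_part \<sigma>)) \<noteq> 0" using \<sigma>'(2) by (rule det_spin)
    {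
      fix \<tau> assume "\<tau> \<in> carrier ?R"
      then have \<tau>: "symmetry P \<tau>" "rotation_matrix (lin_part \<tau>)" by (auto simp: mem_rotation_group)
      have "lin_part (\<sigma> \<circ> \<tau>) = lin_part \<sigma> ** lin_part \<tau>"
        using symmetry_lin_part(2) [OF \<sigma>'(1)] symmetry_lin_part(2) [OF \<tau>(1)] by (rule lin_part_comp)
      then show "\<exists>c. spin (lin_part (\<sigma> \<otimes>\<^bsub>?R\<^esub> \<tau>)) = mat c ** (spin (lin_part \<sigma>) ** spin (lin_part \<tau>))"
        using spin_mult [OF \<sigma>'(2) \<tau>(2)] by (simp add: mult)
    next
      fix c assume "spin (lin_part \<sigma>) = mat c"
      then have "lin_part \<sigma> = mat 1" by (rule spin_faithful [OF \<sigma>'(2)])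
      then have tr: "\<sigma> x = x + \<sigma> 0" for x using symmetry_lin_part(2) [OF \<sigma>'(1), of x] by simp
      have "(\<lambda>x. x + \<sigma> 0) ` P \<subseteq> P"
      proof -
        have "\<sigma> ` P \<subseteq> P" using \<sigma>'(1) by (simp add: symmetry_def)
        moreover have "(\<lambda>x. x + \<sigma> 0) ` P = \<sigma> ` P" by (rule image_cong [OF HOL.refl tr [symmetric]])
        ultimately show ?thesis by simp
      qed
      then have "\<sigma> 0 = 0" by (rule no_translation)
      then have "\<sigma> x = id x" for x using tr [of x] by simp
      then have "\<sigma> = id" by blast
      then show "\<sigma> \<otimes>\<^bsub>?R\<^esub> \<sigma> = \<sigma>" by (simp add: mult)
    }
  qed
  then show "\<exists>A. moebius_group \<Gamma> A" by blast
  show "carrier \<Gamma> \<noteq> {\<one>\<^bsub>\<Gamma>\<^esub>}"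
  proof
    assume triv: "carrier \<Gamma> = {\<one>\<^bsub>\<Gamma>\<^esub>}"
    have "carrier ?R = h ` carrier \<Gamma>" using h by (auto simp: iso_def bij_betw_def)
    then have "carrier ?R = {h \<one>\<^bsub>\<Gamma>\<^esub>}" using triv by simp
    moreover have "id \<in> carrier ?R"
    proof -
      have "lin_part id = mat 1" using lin_part_affine [of "mat 1" 0] by (simp add: id_def)
      then show ?thesis
        by (simp add: mem_rotation_group symmetry_def rotation_matrix_def orthogonal_matrix_def)
    qed
    ultimately show False using regular_polyhedron_nontrivial_rotation [OF P] by auto
  qed
qed

section \<open>Cayley digraphs of dihedral and polyhedral groups\<close>

theorem corollary12:
  fixes \<Gamma> :: "('g, 'm) monoid_scheme" and S :: "'g set"
  assumes "group \<Gamma>"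
    and "(\<exists>n\<ge>1. \<Gamma> \<cong> dihedral_group n) \<or>
         (\<exists>P. regular_polyhedron P \<and> \<Gamma> \<cong> rotation_group P)"
    and "finite S" and "S \<subseteq> carrier \<Gamma>" and "\<one>\<^bsub>\<Gamma>\<^esub> \<notin> S"
  shows "(generate \<Gamma> S = carrier \<Gamma> \<longrightarrow> polynomial_digraph (cayley_digraph \<Gamma> S)) \<and>
         (S \<noteq> {} \<longrightarrow>
            (\<forall>u \<in> carrier \<Gamma>. polynomial_digraph (component (cayley_digraph \<Gamma> S) u)) \<and>
            (\<exists>\<Phi> V. standard_poly \<Phi> \<and> union_of_nonsingular_components \<Phi> V \<and>
               digraph_iso (cayley_digraph \<Gamma> S) (poly_digraph \<Phi> \<restriction> V)))"
proof -
  have "(\<exists>A. moebius_group \<Gamma> A) \<and> carrier \<Gamma> \<noteq> {\<one>\<^bsub>\<Gamma>\<^esub>}"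
    using assms(2)
  proof (elim disjE exE conjE)
    fix n :: nat
    assume "n \<ge> 1" "\<Gamma> \<cong> dihedral_group n"
    then show ?thesis using moebius_group_dihedral [OF assms(1)] by blast
  next
    fix P
    assume "regular_polyhedron P" "\<Gamma> \<cong> rotation_group P"
    then show ?thesis using moebius_group_rotation_group [OF assms(1)] by blast
  qed
  then obtain A where A: "moebius_group \<Gamma> A" and nontrivial: "carrier \<Gamma> \<noteq> {\<one>\<^bsub>\<Gamma>\<^esub>}" by blast
  interpret moebius_group \<Gamma> A by (rule A)
  note polynomial = cayley_digraph_polynomial [OF assms(4) _ assms(5)]
  have "polynomial_digraph (cayley_digraph \<Gamma> S)" if gen: "generate \<Gamma> S = carrier \<Gamma>"
  proof -
    have "S \<noteq> {}" using gen nontrivial generate_empty by auto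
    then have "polynomial_digraph (component (cayley_digraph \<Gamma> S) \<one>\<^bsub>\<Gamma>\<^esub>)"
      by (rule polynomial(1)) (rule one_closed)
    moreover have "component (cayley_digraph \<Gamma> S) \<one>\<^bsub>\<Gamma>\<^esub> = cayley_digraph \<Gamma> S"
      unfolding component_def component_verts_cayley_generate [OF assms(4) gen one_closed]
      by (rule cayley_digraph_induce_carrier [OF assms(4)])
    ultimately show ?thesis by simp
  qed
  then show ?thesis using polynomial by blast
qed

end
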